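(* Let $p \in [1,\infty]$, $B > 0$ and $\theta \in \mathbb{R}$. Let $X \subset \mathbb{R}$ be a set of uniqueness for $\mathrm{PW}_{2B}^1$ and let $\Omega \subset \mathbb{R}$ be a countable set such that $\sum_{\omega \in \Omega \setminus \{0\}} |\omega|^{-1}$ diverges. Then, for all $f,g \in \mathcal{F}_\theta L^p([-B,B])$, the following are equivalent: 1. $f = \mathrm{e}^{\mathrm{i}\alpha} g$ for some $\alpha \in \mathbb{R}$; 2. $|\mathcal{G} f| = |\mathcal{G} g|$ on $\operatorname{R}_\theta(\Omega \times X)$.
   Context: Functions are complex-valued. $\mathcal{S}(\mathbb{R})$ is the Schwartz space, $\mathcal{S}'(\mathbb{R})$ the space of tempered distributions, and $\langle f,\psi\rangle$ (for $f \in \mathcal{S}'(\mathbb{R})$, $\psi\in\mathcal{S}(\mathbb{R})$) the bilinear duality pairing, so that $\langle f,\psi\rangle = \int_{\mathbb{R}} f\psi$ when $f$ is a function. $L^p([-B,B])$ is regarded as the space of $L^p(\mathbb{R})$ functions vanishing outside $[-B,B]$. Fourier transform: $\mathcal{F} f(\xi) = \int_{\mathbb{R}} f(t) \mathrm{e}^{-2\pi \mathrm{i} t\xi}\,\mathrm{d}t$ on $\mathcal{S}(\mathbb{R})$, extended to $\mathcal{S}'(\mathbb{R})$. Paley--Wiener space: for $C>0$ and $p\in[1,\infty]$, $\mathrm{PW}_C^p := \{ f \in \mathcal{S}'(\mathbb{R}) : f = \mathcal{F}F \text{ for some } F \in L^p([-C,C]) \}$; its elements are continuous functions. A set $X \subset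 \mathbb{R}$ is a set of uniqueness for $\mathrm{PW}_C^p$ if, for $f \in \mathrm{PW}_C^p$, $f(x)=0$ for all $x \in X$ implies $f=0$. Fractional Fourier transform: for $f \in \mathcal{S}(\mathbb{R})$ and $\theta \in \mathbb{R}\setminus\pi\mathbb{Z}$, $$\mathcal{F}_\theta f(\xi) := c_\theta\, \mathrm{e}^{\pi \mathrm{i} \xi^2 \cot\theta} \int_{\mathbb{R}} f(t)\, \mathrm{e}^{\pi \mathrm{i} t^2\cot\theta}\, \mathrm{e}^{-2\pi \mathrm{i} \frac{t\xi}{\sin\theta}}\,\mathrm{d}t, \qquad \xi\in\mathbb{R},$$ where $c_\theta$ is the square root of $1-\mathrm{i}\cot\theta$ with positive real part; and $\mathcal{F}_{2k\pi}f := f$, $\mathcal{F}_{(2k+1)\pi}f(\xi) := f(-\xi)$ for $k \in \mathbb{Z}$. It maps $\mathcal{S}(\mathbb{R})$ to $\mathcal{S}(\mathbb{R})$ and is extended to $f\in\mathcal{S}'(\mathbb{R})$ by $\langle \mathcal{F}_\theta f,\psi\rangle := \langle f,\mathcal{F}_\theta\psi\rangle$, $\psi \in \mathcal{S}(\mathbb{R})$. Then $$\mathcal{F}_\theta L^p([-B,B]) := \{ f\in\mathcal{S}'(\mathbb{R}) : f = \mathcal{F}_\theta F \text{ for some } F \in L^p([-B,B]) \}.$$ Rotation: $\operatorname{R}_\theta(x,\omega) := (x\cos\theta - \omega\sin\theta,\; x\sin\theta+\omega\cos\theta)$ for $(x,\omega)\in\mathbb{R}^2$. Gabor transform of $f \in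 \mathcal{S}'(\mathbb{R})$: $\mathcal{G} f(x,\omega) := \langle f, \operatorname{M}_\omega \operatorname{T}_x \phi\rangle$ for $(x,\omega) \in \mathbb{R}^2$, where $\phi(t) = 2^{1/4}\mathrm{e}^{-\pi t^2}$, $\operatorname{T}_x h(t) := h(t-x)$ and $\operatorname{M}_\omega h(t) := \mathrm{e}^{2\pi \mathrm{i} t\omega}h(t)$. *)

theory Defs
  imports "HOL-Analysis.Analysis"
begin

subsection \<open>Schwartz functions and tempered distributions\<close>

definition iter_deriv :: "nat \<Rightarrow> (real \<Rightarrow> complex) \<Rightarrow> real \<Rightarrow> complex" where
  "iter_deriv k = (\<lambda>h x. vector_derivative h (at x)) ^^ k"

definition schwartz_space :: "(real \<Rightarrow> complex) set" where
  "schwartz_space = {\<psi>.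
     (\<forall>k x. iter_deriv k \<psi> differentiable (at x)) \<and>
     (\<forall>j k. bounded (range (\<lambda>x. of_real (x ^ j) * iter_deriv k \<psi> x)))}"

definition schwartz_seminorm :: "nat \<Rightarrow> nat \<Rightarrow> (real \<Rightarrow> complex) \<Rightarrow> real" where
  "schwartz_seminorm j k \<psi> = (SUP x. \<bar>x\<bar> ^ j * cmod (iter_deriv k \<psi> x))"

definition schwartz_topology :: "(real \<Rightarrow> complex) topology" where
  "schwartz_topology = topology_generated_by
     {{\<psi> \<in> schwartz_space. schwartz_seminorm j k (\<lambda>t. \<psi> t - \<psi>0 t) < e} | j k \<psi>0 e.
        \<psi>0 \<in> schwartz_space \<and> e > 0}"

text \<open>
  A distribution is a functional on all functions \<^typ>\<open>real \<Rightarrow> complex\<close>, normalised to be \<open>0\<close> off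
  the Schwartz space. Thus equality of functionals is equality of distributions, and scalar
  multiples may be formed pointwise.
\<close>

type_synonym distr = "(real \<Rightarrow> complex) \<Rightarrow> complex"

definition tempered_distributions :: "distr set" where
  "tempered_distributions = {T.
     (\<forall>\<psi>. \<psi> \<notin> schwartz_space \<longrightarrow> T \<psi> = 0) \<and>
     (\<forall>\<psi>\<in>schwartz_space. \<forall>\<eta>\<in>schwartz_space. T (\<lambda>t. \<psi> t + \<eta> t) = T \<psi> + T \<eta>) \<and>
     (\<forall>\<psi>\<in>schwartz_space. \<forall>c. T (\<lambda>t. c * \<psi> t) = c * T \<psi>) \<and>
     continuous_map schwartz_topology euclidean T}"

definition distr_of_fun :: "(real \<Rightarrow> complex) \<Rightarrow> distr" where
  "distr_of_fun F \<psi> = (if \<psi> \<in> schwartz_space then (LINT t|lborel. F t * \<psi> t) else 0)"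

text \<open>
  Extension of an operator on the Schwartz space to distributions by
  \<open>\<langle>A f, \<psi>\<rangle> = \<langle>f, A \<psi>\<rangle>\<close>, for operators (such as the Fourier transforms below) that equal their
  own transpose for the bilinear pairing.
\<close>

definition distr_ext :: "((real \<Rightarrow> complex) \<Rightarrow> (real \<Rightarrow> complex)) \<Rightarrow> distr \<Rightarrow> distr" where
  "distr_ext A f \<psi> = (if \<psi> \<in> schwartz_space then f (A \<psi>) else 0)"

text \<open>
  Functions are not identified when equal almost everywhere, so vanishing outside \<open>[-B,B]\<close> is
  only required almost everywhere; \<^const>\<open>distr_of_fun\<close> depends only on the class of \<open>F\<close>.
\<close>

definition Lp_interval :: "ennreal \<Rightarrow> real \<Rightarrow> (real \<Rightarrow> complex) set" where
  "Lp_interval p B = {F \<in> borel_measurable lborel.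
     (AE t in lborel. t \<notin> {-B..B} \<longrightarrow> F t = 0) \<and>
     (if p = \<infinity> then \<exists>C. AE t in lborel. cmod (F t) \<le> C
      else integrable lborel (\<lambda>t. cmod (F t) powr enn2real p))}"

subsection \<open>Paley--Wiener spaces\<close>

definition fourier :: "(real \<Rightarrow> complex) \<Rightarrow> real \<Rightarrow> complex" where
  "fourier \<psi> \<xi> = (LINT t|lborel. \<psi> t * exp (- 2 * of_real pi * \<i> * of_real t * of_real \<xi>))"

definition PW :: "ennreal \<Rightarrow> real \<Rightarrow> distr set" where
  "PW p C = {f \<in> tempered_distributions.
     \<exists>F \<in> Lp_interval p C. f = distr_ext fourier (distr_of_fun F)}"

text \<open>
  Elements of \<^const>\<open>PW\<close> are distributions; their pointwise values are those of the (unique)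
  continuous function \<open>h\<close> representing them.
\<close>

definition continuous_representative :: "(real \<Rightarrow> complex) \<Rightarrow> distr \<Rightarrow> bool" where
  "continuous_representative h f \<longleftrightarrow>
     continuous_on UNIV h \<and>
     (\<forall>\<psi>\<in>schwartz_space. integrable lborel (\<lambda>t. h t * \<psi> t)) \<and>
     f = distr_of_fun h"

definition uniqueness_set_PW :: "ennreal \<Rightarrow> real \<Rightarrow> real set \<Rightarrow> bool" where
  "uniqueness_set_PW p C X \<longleftrightarrow>
     (\<forall>f \<in> PW p C. \<forall>h. continuous_representative h f \<and> (\<forall>x\<in>X. h x = 0) \<longrightarrow> f = (\<lambda>\<psi>. 0))"

subsection \<open>Fractional Fourier transform\<close>

text \<open>
  Since \<open>1 - \<i> cot \<theta>\<close> has positive real part, its principal root \<^const>\<open>csqrt\<close> is the square root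
  with positive real part.
\<close>

definition frft :: "real \<Rightarrow> (real \<Rightarrow> complex) \<Rightarrow> real \<Rightarrow> complex" where
  "frft \<theta> \<psi> \<xi> =
     (if \<exists>k::int. \<theta> = 2 * of_int k * pi then \<psi> \<xi>
      else if \<exists>k::int. \<theta> = (2 * of_int k + 1) * pi then \<psi> (- \<xi>)
      else csqrt (1 - \<i> * of_real (cot \<theta>)) * exp (of_real pi * \<i> * of_real (\<xi>\<^sup>2 * cot \<theta>)) *
        (LINT t|lborel. \<psi> t * exp (of_real pi * \<i> * of_real (t\<^sup>2 * cot \<theta>)) *
           exp (- 2 * of_real pi * \<i> * of_real (t * \<xi> / sin \<theta>))))"

definition frft_Lp :: "real \<Rightarrow> ennreal \<Rightarrow> real \<Rightarrow> distr set" where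
  "frft_Lp \<theta> p B = {f \<in> tempered_distributions.
     \<exists>F \<in> Lp_interval p B. f = distr_ext (frft \<theta>) (distr_of_fun F)}"

subsection \<open>Gabor transform\<close>

definition rotation :: "real \<Rightarrow> real \<times> real \<Rightarrow> real \<times> real" where
  "rotation \<theta> = (\<lambda>(x, \<omega>). (x * cos \<theta> - \<omega> * sin \<theta>, x * sin \<theta> + \<omega> * cos \<theta>))"

definition gaussian :: "real \<Rightarrow> complex" where
  "gaussian t = of_real (2 powr (1/4) * exp (- pi * t\<^sup>2))"

definition translation :: "real \<Rightarrow> (real \<Rightarrow> complex) \<Rightarrow> real \<Rightarrow> complex" where
  "translation x h t = h (t - x)"

definition modulation :: "real \<Rightarrow> (real \<Rightarrow> complex) \<Rightarrow> real \<Rightarrow> complex" where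
  "modulation \<omega> h t = exp (2 * of_real pi * \<i> * of_real t * of_real \<omega>) * h t"

text \<open>The pairing is bilinear: the window is not conjugated.\<close>

definition gabor :: "distr \<Rightarrow> real \<times> real \<Rightarrow> complex" where
  "gabor f = (\<lambda>(x, \<omega>). f (modulation \<omega> (translation x gaussian)))"

end

theory Submission
  imports Defs "HOL-Probability.Sinc_Integral"
begin

text \<open>
  The fractional Fourier transform sends a Gabor atom to a nonzero multiple of the rotated atom.
  Hence, writing \<open>f = \<F>\<^sub>\<theta> F\<close> and \<open>g = \<F>\<^sub>\<theta> G\<close> with \<open>F, G\<close> supported in \<open>[-B,B]\<close>, equality of the Gabor
  moduli on the rotated grid says that \<open>\<bar>\<integral> F(t) \<phi>(t-\<omega>) exp(2\<pi>\<i>tx) dt\<bar>\<close> agrees with the same expression for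
  \<open>G\<close> for all \<open>\<omega> \<in> \<Omega>\<close> and \<open>x \<in> X\<close> (lemmas \<open>frft_gabor_atom\<close> and \<open>gabor_frft\<close>).

  For fixed \<open>\<omega>\<close>, the difference of the squared moduli is, as a function of \<open>x\<close>, the Fourier
  transform of an integrable function supported in \<open>[-2B,2B]\<close>, namely the difference of the
  autocorrelations of \<open>F \<phi>(\<cdot>-\<omega>)\<close> and \<open>G \<phi>(\<cdot>-\<omega>)\<close>. It vanishes on the set of uniqueness \<open>X\<close>, hence
  as a distribution. Pairing it with modulated Gaussians and expanding the squares in the exponents
  turns this into
  \<open>\<integral>\<integral> K(t,s) w(t,s) exp(2\<pi>\<omega>(t+s)) exp(2\<pi>y(s-t)) dt ds = 0\<close> for all \<open>\<omega> \<in> \<Omega>\<close> and all real \<open>y\<close>, where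
  \<open>K(t,s) = F(t) F(s)\<^sup>* - G(t) G(s)\<^sup>*\<close> and \<open>w\<close> is a positive Gaussian weight
  (lemma \<open>spectrogram_orthogonality\<close>).

  In the variable \<open>t + s\<close>, which is bounded on the support of \<open>K\<close>, the exponents \<open>\<omega> \<in> \<Omega>\<close> satisfy the
  Muntz condition on at least one half-line, so the integral vanishes for a whole half-line of
  exponents in place of \<open>2\<pi>\<omega>\<close> (lemmas \<open>muntz_approximation\<close> and \<open>exponential_moments_vanish\<close>). The
  resulting exponentials in \<open>t + s\<close> and \<open>s - t\<close> span an algebra of functions that separates points,
  so Stone--Weierstrass gives \<open>K w = 0\<close>, i.e. \<open>F \<otimes> F\<^sup>* = G \<otimes> G\<^sup>*\<close> almost everywhere
  (lemma \<open>tensor_squares_eq\<close>). Such an identity of rank-one kernels forces \<open>F = exp(\<i>\<alpha>) G\<close>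
  (lemma \<open>phase_if_tensor_squares_eq\<close>).
\<close>

section \<open>Schwartz functions\<close>

lemma iter_deriv_0 [simp]: "iter_deriv 0 h = h"
  by (simp add: iter_deriv_def)

lemma iter_deriv_Suc: "iter_deriv (Suc k) h = (\<lambda>x. vector_derivative (iter_deriv k h) (at x))"
  by (simp add: iter_deriv_def)

text \<open>
  Membership proofs for the Schwartz space write all derivatives down explicitly; this removes the choice operator
  inside \<^const>\<open>vector_derivative\<close> from them.
\<close>

lemma iter_deriv_eqI:
  assumes "D 0 = h"
    and "\<And>k x. (D k has_vector_derivative D (Suc k) x) (at x)"
  shows "iter_deriv k h = D k"
proof (induction k)
  case (Suc k)
  have "vector_derivative (D k) (at x) = D (Suc k) x" for x
    using assms(2) vector_derivative_at by blast
  then show ?case unfolding iter_deriv_Suc Suc by auto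
qed (use assms in auto)

lemma schwartz_iter_derivs:
  assumes "\<psi> \<in> schwartz_space"
  shows "(iter_deriv k \<psi> has_vector_derivative iter_deriv (Suc k) \<psi> x) (at x)"
  using assms vector_derivative_works unfolding schwartz_space_def iter_deriv_Suc by blast

lemma schwartz_spaceI:
  assumes "D 0 = \<psi>"
    and "\<And>k x. (D k has_vector_derivative D (Suc k) x) (at x)"
    and "\<And>j k. \<exists>C. \<forall>x. \<bar>x\<bar> ^ j * cmod (D k x) \<le> C"
  shows "\<psi> \<in> schwartz_space"
proof -
  have "iter_deriv k \<psi> = D k" for k
    by (intro iter_deriv_eqI assms)
  moreover have "bounded (range (\<lambda>x. of_real (x ^ j) * D k x))" for j k
  proof -
    obtain C where "\<And>x. \<bar>x\<bar> ^ j * cmod (D k x) \<le> C" using assms(3) by blast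
    then show ?thesis
      by (intro boundedI[of _ C]) (auto simp: norm_mult norm_power)
  qed
  moreover have "D k differentiable (at x)" for k x
    using assms(2) differentiableI_vector by blast
  ultimately show ?thesis unfolding schwartz_space_def by simp
qed

lemma schwartz_bound:
  assumes "\<psi> \<in> schwartz_space"
  obtains C where "C > 0" "\<And>x. \<bar>x\<bar> ^ j * cmod (iter_deriv k \<psi> x) \<le> C"
proof -
  have "bounded (range (\<lambda>x. of_real (x ^ j) * iter_deriv k \<psi> x))"
    using assms unfolding schwartz_space_def by simp
  then obtain C where "C > 0" "\<And>x. cmod (of_real (x ^ j) * iter_deriv k \<psi> x) \<le> C"
    unfolding bounded_pos by auto
  then show ?thesis by (intro that[of C]) (auto simp: norm_mult norm_power)
qed

lemma schwartz_seminorm_upper: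
  assumes "\<psi> \<in> schwartz_space"
  shows "\<bar>x\<bar> ^ j * cmod (iter_deriv k \<psi> x) \<le> schwartz_seminorm j k \<psi>"
proof -
  obtain C where "\<And>x. \<bar>x\<bar> ^ j * cmod (iter_deriv k \<psi> x) \<le> C"
    using schwartz_bound[OF assms] by metis
  then show ?thesis unfolding schwartz_seminorm_def
    by (intro cSUP_upper bdd_aboveI2[of _ _ C]) auto
qed

lemma schwartz_lincomb:
  assumes "\<psi> \<in> schwartz_space" "\<eta> \<in> schwartz_space"
  shows "(\<lambda>t. a * \<psi> t + b * \<eta> t) \<in> schwartz_space"
proof (rule schwartz_spaceI[where D = "\<lambda>k t. a * iter_deriv k \<psi> t + b * iter_deriv k \<eta> t"])
  show "((\<lambda>t. a * iter_deriv k \<psi> t + b * iter_deriv k \<eta> t) has_vector_derivative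
         a * iter_deriv (Suc k) \<psi> x + b * iter_deriv (Suc k) \<eta> x) (at x)" for k x
    by (intro derivative_intros schwartz_iter_derivs assms)
next
  fix j k
  obtain C where C: "\<And>x. \<bar>x\<bar> ^ j * cmod (iter_deriv k \<psi> x) \<le> C"
    using schwartz_bound[OF assms(1)] by metis
  obtain C' where C': "\<And>x. \<bar>x\<bar> ^ j * cmod (iter_deriv k \<eta> x) \<le> C'"
    using schwartz_bound[OF assms(2)] by metis
  have "\<bar>x\<bar> ^ j * cmod (a * iter_deriv k \<psi> x + b * iter_deriv k \<eta> x) \<le> cmod a * C + cmod b * C'" for x
  proof -
    have "\<bar>x\<bar> ^ j * cmod (a * iter_deriv k \<psi> x + b * iter_deriv k \<eta> x)
      \<le> \<bar>x\<bar> ^ j * (cmod a * cmod (iter_deriv k \<psi> x) + cmod b * cmod (iter_deriv k \<eta> x))"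
      by (intro mult_left_mono order.trans[OF norm_triangle_ineq]) (auto simp: norm_mult)
    also have "\<dots> = cmod a * (\<bar>x\<bar> ^ j * cmod (iter_deriv k \<psi> x)) + cmod b * (\<bar>x\<bar> ^ j * cmod (iter_deriv k \<eta> x))"
      by (simp add: algebra_simps)
    also have "\<dots> \<le> cmod a * C + cmod b * C'"
      by (intro add_mono mult_left_mono C C') auto
    finally show ?thesis .
  qed
  then show "\<exists>C. \<forall>x. \<bar>x\<bar> ^ j * cmod (a * iter_deriv k \<psi> x + b * iter_deriv k \<eta> x) \<le> C" by blast
qed auto

lemma schwartz_add: "\<psi> \<in> schwartz_space \<Longrightarrow> \<eta> \<in> schwartz_space \<Longrightarrow> (\<lambda>t. \<psi> t + \<eta> t) \<in> schwartz_space"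
  using schwartz_lincomb[of \<psi> \<eta> 1 1] by simp

lemma schwartz_diff: "\<psi> \<in> schwartz_space \<Longrightarrow> \<eta> \<in> schwartz_space \<Longrightarrow> (\<lambda>t. \<psi> t - \<eta> t) \<in> schwartz_space"
  using schwartz_lincomb[of \<psi> \<eta> 1 "-1"] by simp

lemma schwartz_cmult: "\<psi> \<in> schwartz_space \<Longrightarrow> (\<lambda>t. c * \<psi> t) \<in> schwartz_space"
  using schwartz_lincomb[of \<psi> \<psi> c 0] by simp

lemma schwartz_deriv:
  assumes "\<psi> \<in> schwartz_space"
  shows "iter_deriv 1 \<psi> \<in> schwartz_space"
proof (rule schwartz_spaceI[where D = "\<lambda>k. iter_deriv (Suc k) \<psi>"])
  show "\<exists>C. \<forall>x. \<bar>x\<bar> ^ j * cmod (iter_deriv (Suc k) \<psi> x) \<le> C" for j k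
    using schwartz_bound[OF assms, of j "Suc k"] by metis
qed (use schwartz_iter_derivs[OF assms] in auto)

text \<open>
  The derivatives are those of the Leibniz rule for a linear factor: \<open>(t \<psi>)\<^sup>(\<^sup>k\<^sup>) = t
  \<psi>\<^sup>(\<^sup>k\<^sup>) + k \<psi>\<^sup>(\<^sup>k\<^sup>-\<^sup>1\<^sup>)\<close>. At \<open>k =
  0\<close> the truncated subtraction is harmless because of the factor \<open>k\<close>.
\<close>

lemma schwartz_times_id:
  assumes "\<psi> \<in> schwartz_space"
  shows "(\<lambda>t. of_real t * \<psi> t) \<in> schwartz_space"
proof (rule schwartz_spaceI[where D = "\<lambda>k t. of_real t * iter_deriv k \<psi> t + of_nat k * iter_deriv (k - 1) \<psi> t"])
  fix k x
  show "((\<lambda>t. of_real t * iter_deriv k \<psi> t + of_nat k * iter_deriv (k - 1) \<psi> t) has_vector_derivative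
      of_real x * iter_deriv (Suc k) \<psi> x + of_nat (Suc k) * iter_deriv (Suc k - 1) \<psi> x) (at x)"
  proof (cases k)
    case 0
    then show ?thesis
      by (auto intro!: derivative_eq_intros schwartz_iter_derivs[OF assms, of 0, simplified])
  next
    case (Suc m)
    then show ?thesis
      by (auto intro!: derivative_eq_intros schwartz_iter_derivs[OF assms] simp: algebra_simps)
  qed
next
  fix j k
  obtain C where C: "\<And>x. \<bar>x\<bar> ^ Suc j * cmod (iter_deriv k \<psi> x) \<le> C"
    using schwartz_bound[OF assms] by metis
  obtain C' where C': "\<And>x. \<bar>x\<bar> ^ j * cmod (iter_deriv (k - 1) \<psi> x) \<le> C'"
    using schwartz_bound[OF assms] by metis
  have "\<bar>x\<bar> ^ j * cmod (of_real x * iter_deriv k \<psi> x + of_nat k * iter_deriv (k - 1) \<psi> x) \<le> C + k * C'" for x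
  proof -
    have "\<bar>x\<bar> ^ j * cmod (of_real x * iter_deriv k \<psi> x + of_nat k * iter_deriv (k - 1) \<psi> x)
      \<le> \<bar>x\<bar> ^ j * (\<bar>x\<bar> * cmod (iter_deriv k \<psi> x) + k * cmod (iter_deriv (k - 1) \<psi> x))"
      by (intro mult_left_mono order.trans[OF norm_triangle_ineq]) (auto simp: norm_mult)
    also have "\<dots> = \<bar>x\<bar> ^ Suc j * cmod (iter_deriv k \<psi> x) + k * (\<bar>x\<bar> ^ j * cmod (iter_deriv (k - 1) \<psi> x))"
      by (simp add: algebra_simps)
    also have "\<dots> \<le> C + k * C'"
      by (intro add_mono mult_left_mono C C') auto
    finally show ?thesis .
  qed
  then show "\<exists>C. \<forall>x. \<bar>x\<bar> ^ j * cmod (of_real x * iter_deriv k \<psi> x + of_nat k * iter_deriv (k - 1) \<psi> x) \<le> C" by blast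
qed auto

lemma schwartz_times_power:
  assumes "\<psi> \<in> schwartz_space"
  shows "(\<lambda>t. (c * of_real t) ^ k * \<psi> t) \<in> schwartz_space"
proof (induction k)
  case (Suc k)
  show ?case
    using schwartz_cmult[OF schwartz_times_id[OF Suc], of c] by (simp add: algebra_simps)
qed (use assms in simp)

lemma schwartz_continuous:
  assumes "\<psi> \<in> schwartz_space"
  shows "continuous_on UNIV \<psi>"
  using schwartz_iter_derivs[OF assms, of 0]
  by (auto intro!: continuous_at_imp_continuous_on has_vector_derivative_continuous)

lemma schwartz_measurable:
  "\<psi> \<in> schwartz_space \<Longrightarrow> \<psi> \<in> borel_measurable borel"
  by (simp add: schwartz_continuous borel_measurable_continuous_onI)

lemma integrable_inverse_one_plus_square: "integrable lborel (\<lambda>x::real. inverse (1 + x\<^sup>2))"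
  using integrable_inverse_1_plus_square by (simp add: set_integrable_def)

text \<open>
  Only the seminorms with indices \<open>(0,0)\<close> and \<open>(2,0)\<close> enter. The integrable majorant
  \<open>1/(1+x\<^sup>2)\<close> therefore also yields continuity of the pairing with a bounded function.
\<close>

lemma schwartz_decay:
  assumes "\<psi> \<in> schwartz_space"
  shows "cmod (\<psi> x) \<le> (schwartz_seminorm 0 0 \<psi> + schwartz_seminorm 2 0 \<psi>) * inverse (1 + x\<^sup>2)"
proof -
  have "(1 + x\<^sup>2) * cmod (\<psi> x) \<le> schwartz_seminorm 0 0 \<psi> + schwartz_seminorm 2 0 \<psi>"
    using schwartz_seminorm_upper[OF assms, of x 0 0] schwartz_seminorm_upper[OF assms, of x 2 0]
    by (simp add: algebra_simps)
  moreover have "1 + x\<^sup>2 > 0" by (simp add: add_pos_nonneg)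
  ultimately show ?thesis by (simp add: field_simps)
qed

lemma schwartz_integrable:
  assumes "\<psi> \<in> schwartz_space"
  shows "integrable lborel \<psi>"
proof (rule Bochner_Integration.integrable_bound)
  show "integrable lborel (\<lambda>x. (schwartz_seminorm 0 0 \<psi> + schwartz_seminorm 2 0 \<psi>) * inverse (1 + x\<^sup>2))"
    by (intro integrable_mult_right integrable_inverse_one_plus_square)
  show "AE x in lborel. norm (\<psi> x) \<le> norm ((schwartz_seminorm 0 0 \<psi> + schwartz_seminorm 2 0 \<psi>) * inverse (1 + x\<^sup>2))"
    by (rule AE_I2, rule order.trans[OF schwartz_decay[OF assms]]) auto
qed (use schwartz_measurable[OF assms] in simp)

lemma schwartz_tendsto_0:
  assumes "\<psi> \<in> schwartz_space"
  shows "(\<psi> \<longlongrightarrow> 0) at_top" "(\<psi> \<longlongrightarrow> 0) at_bot"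
proof -
  have "((\<lambda>x::real. inverse (1 + x\<^sup>2)) \<longlongrightarrow> 0) at_top"
    by (intro tendsto_inverse_0_at_top filterlim_tendsto_add_at_top[OF tendsto_const]
        filterlim_pow_at_top filterlim_ident) simp_all
  moreover have "((\<lambda>x::real. inverse (1 + x\<^sup>2)) \<longlongrightarrow> 0) at_bot"
    by (intro tendsto_inverse_0_at_top filterlim_tendsto_add_at_top[OF tendsto_const]
        filterlim_pow_at_bot_even filterlim_ident) simp_all
  ultimately have *: "((\<lambda>x::real. inverse (1 + x\<^sup>2)) \<longlongrightarrow> 0) at_top" "((\<lambda>x::real. inverse (1 + x\<^sup>2)) \<longlongrightarrow> 0) at_bot"
    by auto
  from *[THEN tendsto_mult_right_zero[where c = "schwartz_seminorm 0 0 \<psi> + schwartz_seminorm 2 0 \<psi>"]]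
  show "(\<psi> \<longlongrightarrow> 0) at_top" "(\<psi> \<longlongrightarrow> 0) at_bot"
    by (auto intro: Lim_null_comparison[rotated] always_eventually schwartz_decay[OF assms])
qed

section \<open>The Fourier transform on the Schwartz space\<close>

lemma vector_derivative_quotient_tendsto:
  assumes "(f has_vector_derivative f') (at x)"
    and "\<And>n. X n \<noteq> x" "X \<longlonglongrightarrow> x"
  shows "(\<lambda>n. (f (X n) - f x) /\<^sub>R (X n - x) - f') \<longlonglongrightarrow> 0"
proof -
  have "((\<lambda>y. norm ((f y - f x) - (y - x) *\<^sub>R f') / norm (y - x)) \<longlongrightarrow> 0) (at x)"
    using assms(1) unfolding has_vector_derivative_def has_derivative_iff_norm by simp
  then have "(\<lambda>n. norm ((f (X n) - f x) - (X n - x) *\<^sub>R f') / norm (X n - x)) \<longlonglongrightarrow> 0"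
    using assms(2,3) unfolding tendsto_at_iff_sequentially comp_def by auto
  moreover have "norm ((f (X n) - f x) - (X n - x) *\<^sub>R f') / norm (X n - x)
      = norm ((f (X n) - f x) /\<^sub>R (X n - x) - f')" for n
  proof -
    have "(f (X n) - f x) /\<^sub>R (X n - x) - f' = ((f (X n) - f x) - (X n - x) *\<^sub>R f') /\<^sub>R (X n - x)"
      using assms(2)[of n] by (simp add: scaleR_diff_right)
    then show ?thesis by (simp add: divide_inverse mult.commute)
  qed
  ultimately show ?thesis by (simp add: tendsto_norm_zero_iff)
qed

text \<open>
  Differentiation under the integral sign. By the mean value inequality the difference quotients are dominated by
  the bound \<open>w\<close> on the derivatives, so dominated convergence along sequences applies.
\<close>

lemma has_vector_derivative_lebesgue_integral:
  fixes f f' :: "'a \<Rightarrow> real \<Rightarrow> 'b::{banach, second_countable_topology}"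
  assumes int: "\<And>x. integrable M (\<lambda>t. f t x)"
    and deriv: "\<And>t x. (f t has_vector_derivative f' t x) (at x)"
    and meas: "\<And>x. (\<lambda>t. f' t x) \<in> borel_measurable M"
    and bound: "\<And>t x. norm (f' t x) \<le> w t"
    and w: "integrable M w"
  shows "((\<lambda>x. \<integral>t. f t x \<partial>M) has_vector_derivative (\<integral>t. f' t x \<partial>M)) (at x)"
proof -
  have int': "integrable M (\<lambda>t. f' t x)"
    by (rule Bochner_Integration.integrable_bound[OF w meas])
      (auto intro!: AE_I2 order.trans[OF bound])
  have lip: "norm (f t y - f t x) \<le> w t * norm (y - x)" for t y
    by (rule differentiable_bound[where S = UNIV and f' = "\<lambda>x h. h *\<^sub>R f' t x"])
      (use deriv[unfolded has_vector_derivative_def] bound in \<open>auto intro!: onorm_le simp: mult.commute mult_left_mono\<close>)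
  have "((\<lambda>y. norm (((\<integral>t. f t y \<partial>M) - (\<integral>t. f t x \<partial>M)) - (y - x) *\<^sub>R (\<integral>t. f' t x \<partial>M)) / norm (y - x)) \<longlongrightarrow> 0) (at x)"
    unfolding tendsto_at_iff_sequentially
  proof (intro allI impI)
    fix X assume X: "\<forall>i. X i \<in> UNIV - {x}" "X \<longlonglongrightarrow> x"
    define g where "g n t = (f t (X n) - f t x) /\<^sub>R (X n - x) - f' t x" for n t
    have "(\<lambda>n. integral\<^sup>L M (g n)) \<longlonglongrightarrow> (\<integral>t. 0 \<partial>M)"
    proof (rule integral_dominated_convergence[where w = "\<lambda>t. 2 * w t"])
      show "g n \<in> borel_measurable M" for n
        using int meas unfolding g_def by measurable
      show "AE t in M. (\<lambda>n. g n t) \<longlonglongrightarrow> 0"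
        unfolding g_def by (intro AE_I2 vector_derivative_quotient_tendsto deriv) (use X in auto)
      show "AE t in M. norm (g n t) \<le> 2 * w t" for n
      proof (rule AE_I2)
        fix t
        have "norm ((f t (X n) - f t x) /\<^sub>R (X n - x)) \<le> w t"
          using lip[of t "X n"] X(1) by (simp add: divide_inverse[symmetric] pos_divide_le_eq mult.commute[of "inverse _"])
        then show "norm (g n t) \<le> 2 * w t"
          unfolding g_def using norm_triangle_ineq4 bound[of t x] by (smt (verit, best))
      qed
    qed (use w in auto)
    moreover have "integral\<^sup>L M (g n) = ((\<integral>t. f t (X n) \<partial>M) - (\<integral>t. f t x \<partial>M)) /\<^sub>R (X n - x) - (\<integral>t. f' t x \<partial>M)" for n
      unfolding g_def using int int' by simp
    moreover have "norm (((\<integral>t. f t (X n) \<partial>M) - (\<integral>t. f t x \<partial>M)) - (X n - x) *\<^sub>R (\<integral>t. f' t x \<partial>M)) / norm (X n - x)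
      = norm (((\<integral>t. f t (X n) \<partial>M) - (\<integral>t. f t x \<partial>M)) /\<^sub>R (X n - x) - (\<integral>t. f' t x \<partial>M))" for n
    proof -
      have "((\<integral>t. f t (X n) \<partial>M) - (\<integral>t. f t x \<partial>M)) /\<^sub>R (X n - x) - (\<integral>t. f' t x \<partial>M)
        = (((\<integral>t. f t (X n) \<partial>M) - (\<integral>t. f t x \<partial>M)) - (X n - x) *\<^sub>R (\<integral>t. f' t x \<partial>M)) /\<^sub>R (X n - x)"
        using X(1) by (simp add: scaleR_diff_right)
      then show ?thesis by (simp add: divide_inverse mult.commute)
    qed
    ultimately show "((\<lambda>y. norm (((\<integral>t. f t y \<partial>M) - (\<integral>t. f t x \<partial>M)) - (y - x) *\<^sub>R (\<integral>t. f' t x \<partial>M)) / norm (y - x)) \<circ> X) \<longlonglongrightarrow> 0"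
      by (simp add: comp_def tendsto_norm_zero_iff)
  qed
  then show ?thesis
    unfolding has_vector_derivative_def has_derivative_iff_norm
    by (simp add: bounded_linear_scaleR_left)
qed

lemma integral_derivative_eq_0:
  fixes g g' :: "real \<Rightarrow> complex"
  assumes "\<And>x. (g has_vector_derivative g' x) (at x)" "continuous_on UNIV g'"
    and "integrable lborel g'"
    and "(g \<longlongrightarrow> 0) at_top" "(g \<longlongrightarrow> 0) at_bot"
  shows "(LINT x|lborel. g' x) = 0"
proof -
  have "(LBINT x=-\<infinity>..\<infinity>. g' x) = 0 - 0"
    by (rule interval_integral_FTC_integrable)
      (use assms in \<open>auto simp: ereal_tendsto_simps set_integrable_def continuous_on_eq_continuous_at\<close>)
  then show ?thesis
    by (simp add: interval_lebesgue_integral_def set_lebesgue_integral_def)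
qed

lemma cis_has_vector_derivative:
  "((\<lambda>x. cis (c * x)) has_vector_derivative \<i> * of_real c * cis (c * x)) (at x)"
  unfolding cis_conv_exp
  by (auto intro!: derivative_eq_intros has_vector_derivative_real_field simp: algebra_simps)

lemma fourier_cis: "fourier \<psi> \<xi> = (LINT t|lborel. \<psi> t * cis (- 2 * pi * t * \<xi>))"
  unfolding fourier_def cis_conv_exp by (simp add: algebra_simps)

lemma integrable_mult_cis [simp]:
  assumes "integrable lborel (F :: real \<Rightarrow> complex)"
  shows "integrable lborel (\<lambda>t. F t * cis (c * t))"
proof (rule Bochner_Integration.integrable_bound[OF assms])
  show "(\<lambda>t. F t * cis (c * t)) \<in> borel_measurable lborel"
    using assms unfolding cis_conv_exp by measurable
qed (auto simp: norm_mult)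

lemma fourier_has_vector_derivative:
  assumes "integrable lborel F" "integrable lborel (\<lambda>t. of_real t * F t)"
  shows "(fourier F has_vector_derivative fourier (\<lambda>t. (- 2 * pi * \<i> * of_real t) * F t) \<xi>) (at \<xi>)"
proof -
  have *: "integrable lborel (\<lambda>t. (- 2 * pi * \<i> * of_real t) * F t)"
    using integrable_mult_right[OF assms(2), of "- 2 * pi * \<i>"] by (simp add: algebra_simps)
  have "((\<lambda>\<xi>. LINT t|lborel. F t * cis (- 2 * pi * t * \<xi>)) has_vector_derivative
      (LINT t|lborel. (- 2 * pi * \<i> * of_real t) * F t * cis (- 2 * pi * t * \<xi>))) (at \<xi>)"
  proof (rule has_vector_derivative_lebesgue_integral)
    show "integrable lborel (\<lambda>t. F t * cis (- 2 * pi * t * x))" for x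
      using integrable_mult_cis[OF assms(1), of "- 2 * pi * x"] by (simp add: ac_simps)
    show "((\<lambda>x. F t * cis (- 2 * pi * t * x)) has_vector_derivative
        (- 2 * pi * \<i> * of_real t) * F t * cis (- 2 * pi * t * x)) (at x)" for t x
      using has_vector_derivative_mult_right[OF cis_has_vector_derivative[of "- 2 * pi * t" x], of "F t"]
      by (simp add: algebra_simps)
    show "(\<lambda>t. (- 2 * pi * \<i> * of_real t) * F t * cis (- 2 * pi * t * x)) \<in> borel_measurable lborel" for x
      using integrable_mult_cis[OF *, of "- 2 * pi * x"] by (simp add: ac_simps borel_measurable_integrable)
    show "cmod ((- 2 * pi * \<i> * of_real t) * F t * cis (- 2 * pi * t * x)) \<le> cmod ((- 2 * pi * \<i> * of_real t) * F t)" for t x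
      by (simp add: norm_mult)
  qed (use integrable_norm[OF *] in simp)
  then show ?thesis by (simp add: fourier_cis[abs_def])
qed

lemma fourier_bounded:
  "cmod (fourier F \<xi>) \<le> (LINT t|lborel. cmod (F t))"
  unfolding fourier_cis by (rule order.trans[OF integral_norm_bound]) (simp add: norm_mult)

text \<open>
  The difference of the two sides is the integral of the derivative of \<open>\<psi>(t)
  exp(-2\<pi>\<i>t\<xi>)\<close>, a function that vanishes at infinity.
\<close>

lemma fourier_deriv:
  assumes "\<psi> \<in> schwartz_space"
  shows "fourier (iter_deriv 1 \<psi>) \<xi> = 2 * pi * \<i> * of_real \<xi> * fourier \<psi> \<xi>"
proof -
  define e where "e t = cis (- 2 * pi * \<xi> * t)" for t
  have e: "(e has_vector_derivative - 2 * pi * \<i> * of_real \<xi> * e x) (at x)" for x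
    unfolding e_def using cis_has_vector_derivative[of "- 2 * pi * \<xi>" x] by (simp add: algebra_simps)
  have int: "integrable lborel (\<lambda>t. \<psi> t * e t)" "integrable lborel (\<lambda>t. iter_deriv 1 \<psi> t * e t)"
    unfolding e_def by (intro integrable_mult_cis schwartz_integrable schwartz_deriv assms)+
  have cont: "continuous_on UNIV e"
    using e by (auto intro!: continuous_at_imp_continuous_on has_vector_derivative_continuous)
  have zero: "((\<lambda>t. \<psi> t * e t) \<longlongrightarrow> 0) F" if "(\<psi> \<longlongrightarrow> 0) F" for F
    using that by (subst (asm) tendsto_norm_zero_iff[symmetric], subst tendsto_norm_zero_iff[symmetric])
      (simp add: norm_mult e_def)
  have "(LINT t|lborel. iter_deriv 1 \<psi> t * e t - 2 * pi * \<i> * of_real \<xi> * (\<psi> t * e t)) = 0"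
  proof (rule integral_derivative_eq_0)
    show "((\<lambda>t. \<psi> t * e t) has_vector_derivative
      iter_deriv 1 \<psi> x * e x - 2 * pi * \<i> * of_real \<xi> * (\<psi> x * e x)) (at x)" for x
      using has_vector_derivative_mult[OF schwartz_iter_derivs[OF assms, of 0 x] e[of x]]
      by (simp add: algebra_simps)
    show "continuous_on UNIV (\<lambda>t. iter_deriv 1 \<psi> t * e t - 2 * pi * \<i> * of_real \<xi> * (\<psi> t * e t))"
      by (intro continuous_intros cont schwartz_continuous schwartz_deriv assms)
  qed (use int zero schwartz_tendsto_0[OF assms] in auto)
  then have "(LINT t|lborel. iter_deriv 1 \<psi> t * e t) = 2 * pi * \<i> * of_real \<xi> * (LINT t|lborel. \<psi> t * e t)"
    using int by simp
  then show ?thesis unfolding fourier_cis e_def by (simp add: ac_simps)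
qed

lemma fourier_iter_deriv:
  assumes "\<psi> \<in> schwartz_space"
  shows "fourier (iter_deriv j \<psi>) \<xi> = (2 * pi * \<i> * of_real \<xi>) ^ j * fourier \<psi> \<xi>"
  using assms
proof (induction j arbitrary: \<psi>)
  case (Suc j)
  have "iter_deriv (Suc j) \<psi> = iter_deriv j (iter_deriv 1 \<psi>)"
    unfolding iter_deriv_def funpow_Suc_right by simp
  then have "fourier (iter_deriv (Suc j) \<psi>) \<xi> = (2 * pi * \<i> * of_real \<xi>) ^ j * fourier (iter_deriv 1 \<psi>) \<xi>"
    using Suc.IH[OF schwartz_deriv[OF Suc.prems]] by simp
  then show ?case unfolding fourier_deriv[OF Suc.prems] by simp
qed simp

text \<open>
  The Fourier transform exchanges differentiation and multiplication by the variable, so all decay and smoothness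
  conditions reduce to boundedness of Fourier transforms of Schwartz functions. The extension of the Fourier
  transform to distributions needs this: a functional is normalised to \<open>0\<close> on functions outside the
  Schwartz space.
\<close>

lemma fourier_schwartz:
  assumes "\<psi> \<in> schwartz_space"
  shows "fourier \<psi> \<in> schwartz_space"
proof (rule schwartz_spaceI[where D = "\<lambda>k. fourier (\<lambda>t. (- 2 * pi * \<i> * of_real t) ^ k * \<psi> t)"])
  note S = schwartz_times_power[OF assms, of "- 2 * pi * \<i>"]
  show "(fourier (\<lambda>t. (- 2 * pi * \<i> * of_real t) ^ k * \<psi> t) has_vector_derivative
      fourier (\<lambda>t. (- 2 * pi * \<i> * of_real t) ^ Suc k * \<psi> t) x) (at x)" for k x
    using fourier_has_vector_derivative[OF schwartz_integrable[OF S[of k]] schwartz_integrable[OF schwartz_times_id[OF S[of k]]], of x]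
    by (simp add: mult.assoc)
  fix j k
  let ?\<eta> = "\<lambda>t. (- 2 * pi * \<i> * of_real t) ^ k * \<psi> t"
  have "\<bar>x\<bar> ^ j * cmod (fourier ?\<eta> x) \<le> (LINT t|lborel. cmod (iter_deriv j ?\<eta> t))" for x
  proof -
    \<comment> \<open>Multiplication by \<open>x\<close> is differentiation up to the factor \<open>2\<pi> \<ge> 1\<close>.\<close>
    have "1 * (\<bar>x\<bar> ^ j * cmod (fourier ?\<eta> x)) \<le> (2 * pi) ^ j * (\<bar>x\<bar> ^ j * cmod (fourier ?\<eta> x))"
      using pi_ge_two by (intro mult_right_mono one_le_power) auto
    also have "\<dots> = cmod (fourier (iter_deriv j ?\<eta>) x)"
      unfolding fourier_iter_deriv[OF S] by (simp add: norm_mult norm_power power_mult_distrib)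
    also have "\<dots> \<le> (LINT t|lborel. cmod (iter_deriv j ?\<eta> t))"
      by (rule fourier_bounded)
    finally show ?thesis by simp
  qed
  then show "\<exists>C. \<forall>x. \<bar>x\<bar> ^ j * cmod (fourier ?\<eta> x) \<le> C" by blast
qed simp

section \<open>Sets of uniqueness tested against Schwartz functions\<close>

lemma topspace_schwartz_topology: "topspace schwartz_topology = schwartz_space"
proof -
  have zero: "iter_deriv k (\<lambda>t. 0) = (\<lambda>t. 0)" for k
    by (rule iter_deriv_eqI) auto
  have "schwartz_seminorm 0 0 (\<lambda>t. \<psi> t - \<psi> t) < 1" for \<psi>
    by (simp add: schwartz_seminorm_def zero)
  then have "\<psi> \<in> \<Union>{{\<psi> \<in> schwartz_space. schwartz_seminorm j k (\<lambda>t. \<psi> t - \<psi>0 t) < e} | j k \<psi>0 e.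
        \<psi>0 \<in> schwartz_space \<and> e > 0}" if "\<psi> \<in> schwartz_space" for \<psi>
    using that by (intro UnionI[of "{\<eta> \<in> schwartz_space. schwartz_seminorm 0 0 (\<lambda>t. \<eta> t - \<psi> t) < 1}"]) force+
  then show ?thesis
    unfolding schwartz_topology_def topology_generated_by_topspace by blast
qed

text \<open>
  A functional controlled by two seminorms is continuous because the intersection of two subbasic neighbourhoods
  is already small enough.
\<close>

lemma continuous_map_schwartz:
  assumes diff: "\<And>\<psi> \<eta>. \<psi> \<in> schwartz_space \<Longrightarrow> \<eta> \<in> schwartz_space \<Longrightarrow> T (\<lambda>t. \<psi> t - \<eta> t) = T \<psi> - T \<eta>"
    and bound: "\<And>\<psi>. \<psi> \<in> schwartz_space \<Longrightarrow>
      cmod (T \<psi>) \<le> C * (schwartz_seminorm 0 0 \<psi> + schwartz_seminorm 2 0 \<psi>)"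
    and "C > 0"
  shows "continuous_map schwartz_topology euclidean T"
  unfolding continuous_map_def topspace_schwartz_topology
proof (intro conjI allI impI)
  fix U :: "complex set"
  assume "openin euclidean U"
  then have U: "open U" by simp
  show "openin schwartz_topology {\<psi> \<in> schwartz_space. T \<psi> \<in> U}"
  proof (subst openin_subopen, intro ballI)
    fix \<psi> assume "\<psi> \<in> {\<psi> \<in> schwartz_space. T \<psi> \<in> U}"
    then have \<psi>: "\<psi> \<in> schwartz_space" "T \<psi> \<in> U" by auto
    then obtain e where e: "e > 0" "ball (T \<psi>) e \<subseteq> U" using U openE by blast
    define N where "N j = {\<eta> \<in> schwartz_space. schwartz_seminorm j 0 (\<lambda>t. \<eta> t - \<psi> t) < e / (2 * C)}" for j
    have pos: "e / (2 * C) > 0" using e \<open>C > 0\<close> by simp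
    have "openin schwartz_topology (N j)" for j
      unfolding schwartz_topology_def N_def using \<psi> pos
      by (intro topology_generated_by_Basis) blast
    then have "openin schwartz_topology (N 0 \<inter> N 2)" by blast
    moreover have "\<psi> \<in> N j" for j
    proof -
      show ?thesis using \<psi> pos by (simp add: N_def schwartz_seminorm_def)
    qed
    moreover have "N 0 \<inter> N 2 \<subseteq> {\<psi> \<in> schwartz_space. T \<psi> \<in> U}"
    proof
      fix \<eta> assume "\<eta> \<in> N 0 \<inter> N 2"
      then have \<eta>: "\<eta> \<in> schwartz_space"
        and "schwartz_seminorm 0 0 (\<lambda>t. \<eta> t - \<psi> t) + schwartz_seminorm 2 0 (\<lambda>t. \<eta> t - \<psi> t) < e / C"
        by (auto simp: N_def)
      then have "C * (schwartz_seminorm 0 0 (\<lambda>t. \<eta> t - \<psi> t) + schwartz_seminorm 2 0 (\<lambda>t. \<eta> t - \<psi> t)) < e"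
        using \<open>C > 0\<close> by (simp add: field_simps)
      then have "cmod (T \<eta> - T \<psi>) < e"
        using bound[OF schwartz_diff[OF \<eta> \<psi>(1)]] diff[OF \<eta> \<psi>(1)] by simp
      then have "T \<eta> \<in> ball (T \<psi>) e" by (simp add: dist_norm norm_minus_commute)
      then show "\<eta> \<in> {\<psi> \<in> schwartz_space. T \<psi> \<in> U}" using \<eta> e by blast
    qed
    ultimately show "\<exists>N. openin schwartz_topology N \<and> \<psi> \<in> N \<and> N \<subseteq> {\<psi> \<in> schwartz_space. T \<psi> \<in> U}"
      by blast
  qed
qed auto

lemma integrable_bounded_mult:
  fixes \<psi> h :: "'a \<Rightarrow> complex"
  assumes "integrable M \<psi>" "h \<in> borel_measurable M" "\<And>x. cmod (h x) \<le> C"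
  shows "integrable M (\<lambda>x. h x * \<psi> x)"
proof (rule Bochner_Integration.integrable_bound)
  show "integrable M (\<lambda>x. of_real C * \<psi> x)" using assms by auto
  have "cmod (h x) \<le> \<bar>C\<bar>" for x using assms(3)[of x] by linarith
  then show "AE x in M. cmod (h x * \<psi> x) \<le> cmod (of_real C * \<psi> x)"
    by (auto simp: norm_mult mult_right_mono)
qed (use assms in measurable)

lemma bounded_fun_tempered:
  assumes "h \<in> borel_measurable lborel" "\<And>x. cmod (h x) \<le> C"
  shows "distr_of_fun h \<in> tempered_distributions"
proof -
  have int: "integrable lborel (\<lambda>t. h t * \<psi> t)" if "\<psi> \<in> schwartz_space" for \<psi>
    using integrable_bounded_mult[OF schwartz_integrable[OF that] assms] .
  have C: "C \<ge> 0" using assms(2)[of 0] norm_ge_zero order_trans by blast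
  define I where "I = (LINT x|lborel. inverse (1 + x\<^sup>2 :: real))"
  have "continuous_map schwartz_topology euclidean (distr_of_fun h)"
  proof (rule continuous_map_schwartz[where C = "C * \<bar>I\<bar> + 1"])
    fix \<psi> \<eta> :: "real \<Rightarrow> complex"
    assume "\<psi> \<in> schwartz_space" "\<eta> \<in> schwartz_space"
    then show "distr_of_fun h (\<lambda>t. \<psi> t - \<eta> t) = distr_of_fun h \<psi> - distr_of_fun h \<eta>"
      using int by (simp add: distr_of_fun_def schwartz_diff right_diff_distrib)
  next
    fix \<psi> :: "real \<Rightarrow> complex"
    assume \<psi>: "\<psi> \<in> schwartz_space"
    let ?p = "schwartz_seminorm 0 0 \<psi> + schwartz_seminorm 2 0 \<psi>"
    have p: "?p \<ge> 0"
      using schwartz_seminorm_upper[OF \<psi>, of 1 0 0] schwartz_seminorm_upper[OF \<psi>, of 1 2 0]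
        norm_ge_zero[of "\<psi> 1"] by (simp del: norm_ge_zero)
    have "cmod (distr_of_fun h \<psi>) \<le> (LINT t|lborel. cmod (h t * \<psi> t))"
      using \<psi> by (simp add: distr_of_fun_def integral_norm_bound)
    also have "\<dots> \<le> (LINT t|lborel. C * ?p * inverse (1 + t\<^sup>2))"
    proof (rule integral_mono)
      show "cmod (h t * \<psi> t) \<le> C * ?p * inverse (1 + t\<^sup>2)" for t
        using mult_mono[OF assms(2)[of t] schwartz_decay[OF \<psi>, of t] C] by (simp add: norm_mult mult.assoc)
      show "integrable lborel (\<lambda>t. C * ?p * inverse (1 + t\<^sup>2))"
        by (rule integrable_mult_right[OF integrable_inverse_one_plus_square])
    qed (use int \<psi> in auto)
    also have "\<dots> = C * ?p * I" unfolding I_def by simp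
    also have "\<dots> \<le> (C * \<bar>I\<bar> + 1) * ?p"
    proof -
      have "C * ?p * I \<le> C * ?p * \<bar>I\<bar>" using C p by (intro mult_left_mono) auto
      also have "\<dots> \<le> (C * \<bar>I\<bar> + 1) * ?p" using p by (simp add: algebra_simps)
      finally show ?thesis .
    qed
    finally show "cmod (distr_of_fun h \<psi>) \<le> (C * \<bar>I\<bar> + 1) * ?p" .
  qed (use C in \<open>simp add: add_nonneg_pos\<close>)
  moreover have "distr_of_fun h (\<lambda>t. \<psi> t + \<eta> t) = distr_of_fun h \<psi> + distr_of_fun h \<eta>"
    if "\<psi> \<in> schwartz_space" "\<eta> \<in> schwartz_space" for \<psi> \<eta>
    using that int by (simp add: distr_of_fun_def schwartz_add distrib_left)
  moreover have "distr_of_fun h (\<lambda>t. c * \<psi> t) = c * distr_of_fun h \<psi>" if "\<psi> \<in> schwartz_space" for c \<psi>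
  proof -
    have "(LINT t|lborel. h t * (c * \<psi> t)) = (LINT t|lborel. c * (h t * \<psi> t))"
      by (simp add: ac_simps)
    then show ?thesis using that by (simp add: distr_of_fun_def schwartz_cmult)
  qed
  ultimately show ?thesis
    unfolding tempered_distributions_def by (simp add: distr_of_fun_def)
qed

lemma integrable_tensor:
  fixes f g :: "real \<Rightarrow> complex"
  assumes "integrable lborel f" "integrable lborel g"
  shows "integrable (lborel \<Otimes>\<^sub>M lborel) (\<lambda>(x, y). f x * g y)"
proof (rule lborel_pair.Fubini_integrable)
  show "(\<lambda>(x, y). f x * g y) \<in> borel_measurable (lborel \<Otimes>\<^sub>M lborel)"
    using assms by measurable
  show "integrable lborel (\<lambda>x. LINT y|lborel. cmod (case (x, y) of (x, y) \<Rightarrow> f x * g y))"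
    using assms by (simp add: norm_mult)
  show "AE x in lborel. integrable lborel (\<lambda>y. case (x, y) of (x, y) \<Rightarrow> f x * g y)"
    using assms by simp
qed

lemma integral_tensor:
  fixes f g :: "real \<Rightarrow> complex"
  assumes "integrable lborel f" "integrable lborel g"
  shows "integral\<^sup>L (lborel \<Otimes>\<^sub>M lborel) (\<lambda>(x, y). f x * g y) = (LINT x|lborel. f x) * (LINT y|lborel. g y)"
  by (subst lborel_pair.integral_fst'[symmetric]) (use integrable_tensor[OF assms] in simp_all)

text \<open>
  Fubini for the kernel \<open>F(t) \<psi>(\<xi>)
  exp(-2\<pi>\<i>t\<xi>)\<close>, which is symmetric in the two variables.
\<close>

lemma fourier_multiplication_formula:
  assumes "integrable lborel F" "integrable lborel \<psi>"
  shows "(LINT \<xi>|lborel. fourier F \<xi> * \<psi> \<xi>) = (LINT t|lborel. F t * fourier \<psi> t)"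
proof -
  have "integrable (lborel \<Otimes>\<^sub>M lborel) (\<lambda>z. cis (- 2 * pi * fst z * snd z) * (case z of (t, \<xi>) \<Rightarrow> F t * \<psi> \<xi>))"
    by (rule integrable_bounded_mult[OF integrable_tensor[OF assms], of _ 1])
      (simp_all add: cis_conv_exp)
  then have *: "integrable (lborel \<Otimes>\<^sub>M lborel) (\<lambda>(t, \<xi>). F t * \<psi> \<xi> * cis (- 2 * pi * t * \<xi>))"
    by (simp add: case_prod_unfold mult.commute)
  have "(LINT \<xi>|lborel. fourier F \<xi> * \<psi> \<xi>) = (LINT \<xi>|lborel. LINT t|lborel. F t * \<psi> \<xi> * cis (- 2 * pi * t * \<xi>))"
    unfolding fourier_cis integral_mult_left_zero[symmetric] by (simp add: ac_simps)
  also have "\<dots> = (LINT t|lborel. LINT \<xi>|lborel. F t * \<psi> \<xi> * cis (- 2 * pi * t * \<xi>))"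
    by (rule lborel_pair.Fubini_integral[OF *])
  also have "\<dots> = (LINT t|lborel. F t * fourier \<psi> t)"
    unfolding fourier_cis integral_mult_right_zero[symmetric] by (simp add: ac_simps)
  finally show ?thesis .
qed

text \<open>
  The set of uniqueness is applied to the bounded continuous function \<open>\<F>F\<close>; compact support makes
  \<open>t F(t)\<close> integrable, so \<open>\<F>F\<close> is differentiable and in particular continuous.
  Vanishing as a distribution is moved back to \<open>F\<close> by the multiplication formula, which is the form
  used later: it can be tested with explicit Gaussians \<open>\<psi>\<close>.
\<close>

lemma uniqueness_set_PW_1:
  assumes "uniqueness_set_PW 1 C X"
    and F: "integrable lborel F" and supp: "\<And>t. t \<notin> {-C..C} \<Longrightarrow> F t = 0"
    and zero: "\<And>x. x \<in> X \<Longrightarrow> fourier F x = 0"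
    and \<psi>: "\<psi> \<in> schwartz_space"
  shows "(LINT t|lborel. F t * fourier \<psi> t) = 0"
proof -
  have tF: "integrable lborel (\<lambda>t. of_real t * F t)"
  proof (rule Bochner_Integration.integrable_bound)
    show "integrable lborel (\<lambda>t. of_real C * F t)" using F by simp
    show "AE t in lborel. norm (of_real t * F t) \<le> norm (of_real C * F t)"
    proof (rule AE_I2)
      show "norm (of_real t * F t) \<le> norm (of_real C * F t)" for t
        using supp[of t] by (cases "t \<in> {-C..C}") (auto simp: norm_mult intro!: mult_right_mono)
    qed
  qed (use F in measurable)
  have cont: "continuous_on UNIV (fourier F)"
    using fourier_has_vector_derivative[OF F tF]
    by (auto intro!: continuous_at_imp_continuous_on has_vector_derivative_continuous)
  then have meas: "fourier F \<in> borel_measurable lborel"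
    by (simp add: borel_measurable_continuous_onI)
  have mf: "(LINT x|lborel. fourier F x * \<eta> x) = (LINT t|lborel. F t * fourier \<eta> t)" if "\<eta> \<in> schwartz_space" for \<eta>
    by (rule fourier_multiplication_formula[OF F schwartz_integrable[OF that]])
  have eq: "distr_of_fun (fourier F) = distr_ext fourier (distr_of_fun F)"
    by (auto simp: fun_eq_iff distr_of_fun_def distr_ext_def fourier_schwartz mf)
  have "F \<in> Lp_interval 1 C"
    using F supp unfolding Lp_interval_def by auto
  then have "distr_of_fun (fourier F) \<in> PW 1 C"
    unfolding PW_def using bounded_fun_tempered[OF meas fourier_bounded] eq by auto
  moreover have "continuous_representative (fourier F) (distr_of_fun (fourier F))"
    unfolding continuous_representative_def
    using cont integrable_bounded_mult[OF schwartz_integrable meas fourier_bounded] by auto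
  ultimately have "distr_of_fun (fourier F) = (\<lambda>\<psi>. 0)"
    using assms(1) zero unfolding uniqueness_set_PW_def by blast
  then have "distr_of_fun (fourier F) \<psi> = 0" by simp
  then show ?thesis using \<psi> mf by (simp add: distr_of_fun_def)
qed

section \<open>Complex Gaussian integrals\<close>

text \<open>
  Half of the quadratic decay absorbs the linear exponent by completing the square; the other half beats the
  power, because \<open>u\<^sup>n/n!\<close> is a term of the exponential series.
\<close>

lemma power_times_gaussian_bounded:
  fixes a b :: real
  assumes "a < 0"
  shows "\<exists>C. \<forall>x. \<bar>x\<bar> ^ n * exp (a * x\<^sup>2 + b * x) \<le> C"
proof -
  \<comment> \<open>Splits the decay rate into two equal parts \<open>r\<close>.\<close>
  define r where "r = - a / 2"
  have r: "r > 0" "a = - 2 * r" using assms by (auto simp: r_def)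
  \<comment> \<open>The maximum of \<open>exp(bx-rx^2)\<close>.\<close>
  define E where "E = exp (b\<^sup>2 / (4 * r))"
  have E: "exp (a * x\<^sup>2 + b * x) \<le> E * exp (- r * x\<^sup>2)" for x
  proof -
    have "b * x - r * x\<^sup>2 \<le> b\<^sup>2 / (4 * r)"
      using zero_le_power2[of "2 * r * x - b"] r by (simp add: field_simps power2_eq_square)
    then have "a * x\<^sup>2 + b * x \<le> b\<^sup>2 / (4 * r) + (- r * x\<^sup>2)" unfolding r(2) by linarith
    then show ?thesis unfolding E_def exp_add[symmetric] by simp
  qed
  have F: "\<bar>x\<bar> ^ (2 * n) * exp (- r * x\<^sup>2) \<le> fact n / r ^ n" for x
  proof -
    have "(r * x\<^sup>2) ^ n / fact n \<le> exp (r * x\<^sup>2)"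
    proof -
      have "(\<Sum>k\<in>{n}. (r * x\<^sup>2) ^ k /\<^sub>R fact k) \<le> (\<Sum>k. (r * x\<^sup>2) ^ k /\<^sub>R fact k)"
        using r by (intro sum_le_suminf summable_exp_generic) auto
      then show ?thesis by (simp add: exp_def divide_inverse mult.commute)
    qed
    then have "(r * x\<^sup>2) ^ n \<le> fact n * exp (r * x\<^sup>2)" by (simp add: field_simps)
    moreover have "(r * x\<^sup>2) ^ n = r ^ n * \<bar>x\<bar> ^ (2 * n)"
      by (simp add: power_mult_distrib power_mult)
    ultimately show ?thesis using r by (simp add: exp_minus field_simps)
  qed
  have "\<bar>x\<bar> ^ n * exp (a * x\<^sup>2 + b * x) \<le> E * (1 + fact n / r ^ n)" for x
  proof -
    have "\<bar>x\<bar> ^ n \<le> 1 + \<bar>x\<bar> ^ (2 * n)"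
    proof (cases "\<bar>x\<bar> \<le> 1")
      case True
      then show ?thesis using power_le_one[of "\<bar>x\<bar>" n] by (simp add: add_increasing2)
    next
      case False
      then have "\<bar>x\<bar> ^ n \<le> \<bar>x\<bar> ^ (2 * n)" by (intro power_increasing) auto
      then show ?thesis by linarith
    qed
    then have "\<bar>x\<bar> ^ n * exp (a * x\<^sup>2 + b * x) \<le> (1 + \<bar>x\<bar> ^ (2 * n)) * (E * exp (- r * x\<^sup>2))"
      by (intro mult_mono E) auto
    also have "\<dots> = E * (exp (- r * x\<^sup>2) + \<bar>x\<bar> ^ (2 * n) * exp (- r * x\<^sup>2))"
      by (simp add: algebra_simps)
    also have "\<dots> \<le> E * (1 + fact n / r ^ n)"
      using r by (intro mult_left_mono add_mono F) (auto simp: E_def)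
    finally show ?thesis .
  qed
  then show ?thesis by blast
qed

lemma poly_times_gaussian_bounded:
  fixes a b :: real
  assumes "a < 0"
  shows "\<exists>C. \<forall>x. \<bar>x\<bar> ^ j * (cmod (poly P (of_real x)) * exp (a * x\<^sup>2 + b * x)) \<le> C"
proof (induction P arbitrary: j)
  case (pCons c P)
  obtain C1 where C1: "\<And>x. \<bar>x\<bar> ^ j * exp (a * x\<^sup>2 + b * x) \<le> C1"
    using power_times_gaussian_bounded[OF assms] by metis
  obtain C2 where C2: "\<And>x. \<bar>x\<bar> ^ Suc j * (cmod (poly P (of_real x)) * exp (a * x\<^sup>2 + b * x)) \<le> C2"
    using pCons.IH by metis
  have "\<bar>x\<bar> ^ j * (cmod (poly (pCons c P) (of_real x)) * exp (a * x\<^sup>2 + b * x)) \<le> cmod c * C1 + C2" for x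
  proof -
    have "\<bar>x\<bar> ^ j * (cmod (poly (pCons c P) (of_real x)) * exp (a * x\<^sup>2 + b * x))
      \<le> \<bar>x\<bar> ^ j * ((cmod c + \<bar>x\<bar> * cmod (poly P (of_real x))) * exp (a * x\<^sup>2 + b * x))"
      by (intro mult_left_mono mult_right_mono) (auto intro: order.trans[OF norm_triangle_ineq] simp: norm_mult)
    also have "\<dots> = cmod c * (\<bar>x\<bar> ^ j * exp (a * x\<^sup>2 + b * x))
        + \<bar>x\<bar> ^ Suc j * (cmod (poly P (of_real x)) * exp (a * x\<^sup>2 + b * x))"
      by (simp add: algebra_simps)
    also have "\<dots> \<le> cmod c * C1 + C2" by (intro add_mono mult_left_mono C1 C2) auto
    finally show ?thesis .
  qed
  then show ?case by blast
qed auto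

text \<open>
  Differentiating \<open>P(t) exp(\<alpha>t^2+\<beta>t)\<close> with a
  polynomial \<open>P\<close> gives the same type of function with \<open>P' + (2\<alpha>t + \<beta>) P\<close> in
  place of \<open>P\<close>.
\<close>

lemma complex_gaussian_schwartz:
  assumes "Re \<alpha> < 0"
  shows "(\<lambda>t. exp (\<alpha> * of_real t ^ 2 + \<beta> * of_real t)) \<in> schwartz_space"
proof (rule schwartz_spaceI)
  define P where "P k = ((\<lambda>Q. pderiv Q + [:\<beta>, 2 * \<alpha>:] * Q) ^^ k) 1" for k
  let ?D = "\<lambda>k t. poly (P k) (of_real t) * exp (\<alpha> * of_real t ^ 2 + \<beta> * of_real t)"
  show "?D 0 = (\<lambda>t. exp (\<alpha> * of_real t ^ 2 + \<beta> * of_real t))" by (simp add: P_def)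
  show "(?D k has_vector_derivative ?D (Suc k) x) (at x)" for k x
    by (rule has_vector_derivative_real_field[where f = "\<lambda>z. poly (P k) z * exp (\<alpha> * z ^ 2 + \<beta> * z)"])
      (auto intro!: derivative_eq_intros poly_DERIV simp: P_def algebra_simps)
  have "cmod (exp (\<alpha> * of_real t ^ 2 + \<beta> * of_real t)) = exp (Re \<alpha> * t\<^sup>2 + Re \<beta> * t)" for t
    by (simp flip: of_real_power)
  then show "\<exists>C. \<forall>x. \<bar>x\<bar> ^ j * cmod (?D k x) \<le> C" for j k
    using poly_times_gaussian_bounded[OF assms, of j "P k" "Re \<beta>"] by (simp add: norm_mult)
qed

lemma has_vector_derivative_zero_imp_const:
  fixes f :: "real \<Rightarrow> 'a::real_normed_vector"
  assumes "\<And>x. (f has_vector_derivative 0) (at x)"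
  shows "f x = f y"
proof -
  have "\<exists>c. \<forall>x\<in>UNIV. f x = c"
    by (rule has_derivative_zero_constant) (use assms in \<open>auto simp: has_vector_derivative_def\<close>)
  then show ?thesis by auto
qed

text \<open>
  The value at a real frequency \<open>\<eta>\<close> of the Fourier integral of a complex Gaussian. Real
  translations of the variable reduce every linear exponent to a purely imaginary one, so complex frequencies do
  not occur.
\<close>

definition gaussian_integral :: "complex \<Rightarrow> real \<Rightarrow> complex" where
  "gaussian_integral \<alpha> \<eta> = (LINT t|lborel. exp (\<alpha> * of_real t ^ 2 + (\<i> * of_real \<eta>) * of_real t))"

lemma complex_gaussian_integrable:
  assumes "Re \<alpha> < 0"
  shows "integrable lborel (\<lambda>t. exp (\<alpha> * of_real t ^ 2 + \<beta> * of_real t))"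
    and "integrable lborel (\<lambda>t. of_real t * exp (\<alpha> * of_real t ^ 2 + \<beta> * of_real t))"
    and "integrable lborel (\<lambda>t. of_real t * (of_real t * exp (\<alpha> * of_real t ^ 2 + \<beta> * of_real t)))"
  by (intro schwartz_integrable schwartz_times_id complex_gaussian_schwartz assms)+

lemma integral_iter_deriv_eq_0:
  assumes "\<psi> \<in> schwartz_space"
  shows "(LINT t|lborel. iter_deriv 1 \<psi> t) = 0"
  using fourier_deriv[OF assms, of 0] by (simp add: fourier_cis)

text \<open>
  Both identities say that the integral of a derivative is zero, for
  \<open>exp(\<alpha>t^2+\<beta>t)\<close> and for \<open>t
  exp(\<alpha>t^2)\<close>. They are what turns the derivatives of Gaussian integrals in a
  parameter into first-order linear differential equations.
\<close>

lemma integral_gaussian_moments: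
  assumes "Re \<alpha> < 0"
  shows "2 * \<alpha> * (LINT t|lborel. of_real t * exp (\<alpha> * of_real t ^ 2 + \<beta> * of_real t))
      = - \<beta> * (LINT t|lborel. exp (\<alpha> * of_real t ^ 2 + \<beta> * of_real t))" (is ?A)
    and "2 * \<alpha> * (LINT t|lborel. of_real t * (of_real t * exp (\<alpha> * of_real t ^ 2)))
      = - (LINT t|lborel. exp (\<alpha> * of_real t ^ 2))" (is ?B)
proof -
  let ?e = "\<lambda>t::real. exp (\<alpha> * of_real t ^ 2 + \<beta> * of_real t)"
  have d: "(?e has_vector_derivative (2 * \<alpha> * of_real t + \<beta>) * ?e t) (at t)" for t
    by (rule has_vector_derivative_real_field[where f = "\<lambda>z. exp (\<alpha> * z ^ 2 + \<beta> * z)"])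
      (auto intro!: derivative_eq_intros)
  then have "iter_deriv 1 ?e = (\<lambda>t. 2 * \<alpha> * (of_real t * ?e t) + \<beta> * ?e t)"
    unfolding One_nat_def iter_deriv_Suc iter_deriv_0 vector_derivative_at[OF d] by (simp add: algebra_simps)
  with integral_iter_deriv_eq_0[OF complex_gaussian_schwartz[OF assms, of \<beta>]] show ?A
    using complex_gaussian_integrable[OF assms, of \<beta>] by (simp add: eq_neg_iff_add_eq_0)
next
  let ?e = "\<lambda>t::real. of_real t * exp (\<alpha> * of_real t ^ 2)"
  have d: "(?e has_vector_derivative 2 * \<alpha> * (of_real t * ?e t) + exp (\<alpha> * of_real t ^ 2)) (at t)" for t
    by (rule has_vector_derivative_real_field[where f = "\<lambda>z. z * exp (\<alpha> * z ^ 2)"])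
      (auto intro!: derivative_eq_intros simp: algebra_simps)
  then have "iter_deriv 1 ?e = (\<lambda>t. 2 * \<alpha> * (of_real t * ?e t) + exp (\<alpha> * of_real t ^ 2))"
    unfolding One_nat_def iter_deriv_Suc iter_deriv_0 vector_derivative_at[OF d] by simp
  with integral_iter_deriv_eq_0[OF schwartz_times_id[OF complex_gaussian_schwartz[OF assms, of 0]]] show ?B
    using complex_gaussian_integrable[OF assms, of 0] by (simp add: eq_neg_iff_add_eq_0)
qed

text \<open>
  As a function of \<open>\<eta>\<close> the integral \<open>I\<close> satisfies \<open>I' = \<eta> I /
  (2\<alpha>)\<close>. This avoids a contour shift for complex \<open>\<alpha>\<close>.
\<close>

lemma gaussian_integral_eq:
  assumes "Re \<alpha> < 0"
  shows "gaussian_integral \<alpha> \<eta> = gaussian_integral \<alpha> 0 * exp (of_real \<eta> ^ 2 / (4 * \<alpha>))"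
proof -
  have \<alpha>: "\<alpha> \<noteq> 0" using assms by auto
  have d: "(gaussian_integral \<alpha> has_vector_derivative of_real \<eta> / (2 * \<alpha>) * gaussian_integral \<alpha> \<eta>) (at \<eta>)" for \<eta>
  proof -
    let ?e = "\<lambda>t \<eta>. exp (\<alpha> * of_real t ^ 2 + (\<i> * of_real \<eta>) * of_real t)"
    have "((\<lambda>\<eta>. LINT t|lborel. ?e t \<eta>) has_vector_derivative (LINT t|lborel. \<i> * (of_real t * ?e t \<eta>))) (at \<eta>)"
    proof (rule has_vector_derivative_lebesgue_integral)
      show "((?e t) has_vector_derivative \<i> * (of_real t * ?e t x)) (at x)" for t x
        by (rule has_vector_derivative_real_field[where f = "\<lambda>z. exp (\<alpha> * of_real t ^ 2 + (\<i> * z) * of_real t)"])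
          (auto intro!: derivative_eq_intros)
      show "cmod (\<i> * (of_real t * ?e t x)) \<le> cmod (of_real t * exp (\<alpha> * of_real t ^ 2 + 0 * of_real t))" for t x
        by (simp add: norm_mult flip: of_real_power)
      show "integrable lborel (\<lambda>t. cmod (of_real t * exp (\<alpha> * of_real t ^ 2 + 0 * of_real t)))"
        by (intro integrable_norm complex_gaussian_integrable assms)
    qed (use complex_gaussian_integrable[OF assms] in \<open>auto intro: borel_measurable_integrable\<close>)
    also have "(LINT t|lborel. \<i> * (of_real t * ?e t \<eta>)) = of_real \<eta> / (2 * \<alpha>) * (LINT t|lborel. ?e t \<eta>)"
      using integral_gaussian_moments(1)[OF assms, of "\<i> * of_real \<eta>"] \<alpha> by (simp add: field_simps)
    finally show ?thesis by (simp add: gaussian_integral_def[abs_def])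
  qed
  have "gaussian_integral \<alpha> \<eta> * exp (- (of_real \<eta> ^ 2 / (4 * \<alpha>))) = gaussian_integral \<alpha> 0 * exp (- (of_real 0 ^ 2 / (4 * \<alpha>)))"
  proof (rule has_vector_derivative_zero_imp_const)
    fix x
    have "((\<lambda>x. exp (- (of_real x ^ 2 / (4 * \<alpha>)))) has_vector_derivative
        - (of_real x / (2 * \<alpha>)) * exp (- (of_real x ^ 2 / (4 * \<alpha>)))) (at x)"
      by (rule has_vector_derivative_real_field[where f = "\<lambda>z. exp (- (z ^ 2 / (4 * \<alpha>)))"])
        (use \<alpha> in \<open>auto intro!: derivative_eq_intros simp: field_simps power2_eq_square\<close>)
    from has_vector_derivative_mult[OF d this]
    show "((\<lambda>x. gaussian_integral \<alpha> x * exp (- (of_real x ^ 2 / (4 * \<alpha>)))) has_vector_derivative 0) (at x)"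
      by (simp add: algebra_simps)
  qed
  then show ?thesis by (simp add: exp_minus field_simps)
qed

text \<open>
  Along the vertical line through \<open>\<alpha>\<close> the product of \<open>\<alpha>\<close> and the squared
  integral has derivative zero, so it equals its value at the real point, where the integrand is positive. No
  branch of the square root has to be chosen, as only non-vanishing is used.
\<close>

lemma gaussian_integral_nonzero:
  assumes "Re \<alpha> < 0"
  shows "gaussian_integral \<alpha> 0 \<noteq> 0"
proof -
  define r where "r = Re \<alpha>"
  define a where "a \<tau> = of_real r + \<i> * of_real \<tau>" for \<tau>
  have a: "Re (a \<tau>) < 0" "a \<tau> \<noteq> 0" for \<tau> using assms by (auto simp: a_def r_def complex_eq_iff)
  define J where "J \<tau> = gaussian_integral (a \<tau>) 0" for \<tau>
  have d: "(J has_vector_derivative - \<i> / (2 * a \<tau>) * J \<tau>) (at \<tau>)" for \<tau>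
  proof -
    let ?e = "\<lambda>t \<tau>. exp (a \<tau> * of_real t ^ 2)"
    have "((\<lambda>\<tau>. LINT t|lborel. ?e t \<tau>) has_vector_derivative (LINT t|lborel. \<i> * (of_real t * (of_real t * ?e t \<tau>)))) (at \<tau>)"
    proof (rule has_vector_derivative_lebesgue_integral)
      show "((?e t) has_vector_derivative \<i> * (of_real t * (of_real t * ?e t x))) (at x)" for t x
        unfolding a_def
        by (rule has_vector_derivative_real_field[where f = "\<lambda>z. exp ((of_real r + \<i> * z) * of_real t ^ 2)"])
          (auto intro!: derivative_eq_intros simp: power2_eq_square)
      show "cmod (\<i> * (of_real t * (of_real t * ?e t x))) \<le> cmod (of_real t * (of_real t * ?e t 0))" for t x
        by (simp add: norm_mult a_def flip: of_real_power)
      show "integrable lborel (\<lambda>t. cmod (of_real t * (of_real t * ?e t 0)))"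
        using complex_gaussian_integrable(3)[OF a(1), of 0 0] by (intro integrable_norm) simp
      show "integrable lborel (\<lambda>t. ?e t x)" for x
        using complex_gaussian_integrable(1)[OF a(1), of x 0] by simp
      show "(\<lambda>t. \<i> * (of_real t * (of_real t * ?e t x))) \<in> borel_measurable lborel" for x
        by measurable
    qed
    also have "(LINT t|lborel. \<i> * (of_real t * (of_real t * ?e t \<tau>))) = - \<i> / (2 * a \<tau>) * (LINT t|lborel. ?e t \<tau>)"
      using integral_gaussian_moments(2)[OF a(1), of \<tau>] a(2)[of \<tau>] by (simp add: field_simps)
    finally show ?thesis by (simp add: J_def[abs_def] gaussian_integral_def)
  qed
  have a': "(a has_vector_derivative \<i>) (at \<tau>)" for \<tau>
    unfolding a_def[abs_def] by (auto intro!: derivative_eq_intros)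
  have "J (Im \<alpha>) * J (Im \<alpha>) * a (Im \<alpha>) = J 0 * J 0 * a 0"
  proof (rule has_vector_derivative_zero_imp_const)
    fix \<tau>
    from has_vector_derivative_mult[OF has_vector_derivative_mult[OF d[of \<tau>] d[of \<tau>]] a'[of \<tau>]]
    show "((\<lambda>\<tau>. J \<tau> * J \<tau> * a \<tau>) has_vector_derivative 0) (at \<tau>)"
      using a(2)[of \<tau>] by (simp add: field_simps)
  qed
  moreover have "J 0 \<noteq> 0"
  proof -
    have int: "integrable lborel (\<lambda>t. exp (r * t\<^sup>2))"
      using complex_gaussian_integrable(1)[OF a(1), of 0 0, THEN integrable_norm]
      by (simp add: a_def flip: of_real_power)
    have "(LINT t|lborel. exp (r * t\<^sup>2)) \<noteq> 0"
    proof -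
      have "\<not> (AE t::real in lborel. False)"
        by (simp add: AE_iff_measurable[of UNIV])
      then show ?thesis
        using integral_nonneg_eq_0_iff_AE[OF int] by simp
    qed
    moreover have "J 0 = of_real (LINT t|lborel. exp (r * t\<^sup>2))"
      unfolding J_def gaussian_integral_def a_def integral_complex_of_real[symmetric] by (simp flip: exp_of_real)
    ultimately show ?thesis by simp
  qed
  ultimately have "J (Im \<alpha>) \<noteq> 0" using a(2)[of 0] by auto
  moreover have "a (Im \<alpha>) = \<alpha>" by (simp add: a_def r_def complex_eq_iff)
  ultimately show ?thesis by (simp add: J_def)
qed

section \<open>The fractional Fourier transform of a Gabor atom\<close>

abbreviation gabor_atom :: "real \<Rightarrow> real \<Rightarrow> real \<Rightarrow> complex" where
  "gabor_atom x \<omega> \<equiv> modulation \<omega> (translation x gaussian)"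

lemma gabor_atom_eq_gaussian:
  "gabor_atom x \<omega> t = of_real (2 powr (1/4) * exp (- pi * x\<^sup>2)) *
     exp (- of_real pi * of_real t ^ 2 + (2 * of_real pi * (of_real x + \<i> * of_real \<omega>)) * of_real t)"
proof -
  have "gaussian (t - x) = of_real (2 powr (1/4) * exp (- pi * x\<^sup>2)) * exp (of_real (- pi * t\<^sup>2 + 2 * pi * x * t))"
  proof -
    have "- pi * (t - x)\<^sup>2 = - pi * x\<^sup>2 + (- pi * t\<^sup>2 + 2 * pi * x * t)"
      by (simp add: power2_eq_square algebra_simps)
    then show ?thesis
      unfolding gaussian_def exp_of_real by (simp only: exp_add of_real_mult mult.assoc)
  qed
  then show ?thesis
    unfolding modulation_def translation_def
    by (simp add: exp_add[symmetric] algebra_simps)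
qed

lemma gabor_atom_schwartz: "gabor_atom x \<omega> \<in> schwartz_space"
proof -
  have "gabor_atom x \<omega> = (\<lambda>t. of_real (2 powr (1/4) * exp (- pi * x\<^sup>2)) *
     exp (- of_real pi * of_real t ^ 2 + (2 * of_real pi * (of_real x + \<i> * of_real \<omega>)) * of_real t))"
    by (rule ext) (rule gabor_atom_eq_gaussian)
  also have "\<dots> \<in> schwartz_space"
    by (intro schwartz_cmult complex_gaussian_schwartz) simp
  finally show ?thesis .
qed

text \<open>
  If \<open>sin \<theta> \<noteq> 0\<close>: after translating the integration variable by \<open>x\<close>, the
  integral is a Gaussian integral with \<open>\<alpha> = -\<pi>(1 - \<i> cot \<theta>)\<close> and frequency
  proportional to \<open>\<omega> + x cot \<theta> - \<xi>/sin \<theta>\<close>. Since \<open>1/(1 - \<i> cot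
  \<theta>) = sin\<^sup>2 \<theta> (1 + \<i> cot \<theta>)\<close>, its real part produces the Gaussian centred at
  \<open>a\<close>, and the imaginary quadratic terms in \<open>\<xi>\<close> cancel against the chirp in front.
  Only \<open>c \<noteq> 0\<close> is recorded: a common factor does not affect the comparison of two moduli.
\<close>

lemma frft_gabor_atom:
  assumes "rotation \<theta> (a, b) = (x, \<omega>)"
  shows "\<exists>c. c \<noteq> 0 \<and> frft \<theta> (gabor_atom x \<omega>) = (\<lambda>\<xi>. c * gabor_atom a b \<xi>)"
proof (cases "sin \<theta> = 0")
  case True
  then obtain k :: int where k: "\<theta> = of_int k * pi" by (auto simp: sin_zero_iff_int2)
  show ?thesis
  proof (cases "even k")
    case True
    then obtain m where m: "k = 2 * m" by blast
    have "\<theta> = 2 * of_int m * pi" using k m by simp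
    moreover from this have "cos \<theta> = 1" by (metis cos_int_2pin mult.commute mult.left_commute)
    ultimately show ?thesis
      using assms \<open>sin \<theta> = 0\<close> by (intro exI[of _ 1]) (auto simp: frft_def fun_eq_iff rotation_def)
  next
    case False
    then obtain m where m: "k = 2 * m + 1" using oddE by blast
    have \<theta>: "\<theta> = (2 * of_int m + 1) * pi" using k m by simp
    then have "\<theta> = of_int m * (2 * pi) + pi" by (simp add: algebra_simps)
    then have "cos \<theta> = -1" using cos_int_2pin[of m] by (simp add: mult.commute)
    moreover have "\<not> (\<exists>k::int. \<theta> = 2 * of_int k * pi)"
    proof
      assume "\<exists>k::int. \<theta> = 2 * of_int k * pi"
      then obtain j :: int where "(2 * of_int m + 1) * pi = 2 * of_int j * pi" using \<theta> by auto
      then have "of_int (2 * m + 1) = (of_int (2 * j) :: real)" by simp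
      then have "2 * m + 1 = 2 * j" unfolding of_int_eq_iff .
      then show False by presburger
    qed
    moreover have "\<exists>k::int. \<theta> = (2 * of_int k + 1) * pi" using \<theta> by blast
    moreover have "gabor_atom (- a) (- b) (- \<xi>) = gabor_atom a b \<xi>" for \<xi>
    proof -
      have "- \<xi> - - a = - (\<xi> - a)" by simp
      then have "gaussian (- \<xi> - - a) = gaussian (\<xi> - a)"
        unfolding gaussian_def by (metis power2_minus)
      then show ?thesis by (simp add: modulation_def translation_def)
    qed
    ultimately show ?thesis
      using assms \<open>sin \<theta> = 0\<close> by (intro exI[of _ 1]) (auto simp: frft_def fun_eq_iff rotation_def)
  qed
next
  case False
  define s where "s = sin \<theta>"
  have s: "s \<noteq> 0" using False by (simp add: s_def)
  define c where "c = cot \<theta>"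
  have cs: "cos \<theta> = c * s" using s by (simp add: c_def s_def cot_def)
  have x: "x = a * c * s - b * s" and \<omega>: "\<omega> = a * s + b * c * s"
    using assms cs by (auto simp: rotation_def s_def)
  \<comment> \<open>This is \<open>1/(1 + cot\<^sup>2 \<theta>) = sin\<^sup>2 \<theta>\<close>.\<close>
  have one: "s\<^sup>2 + c\<^sup>2 * s\<^sup>2 = 1"
    using sin_cos_squared_add[of \<theta>] cs by (simp add: s_def power_mult_distrib)
  define \<alpha> where "\<alpha> = - of_real pi + of_real pi * \<i> * of_real c"
  have \<alpha>: "Re \<alpha> < 0" "\<alpha> \<noteq> 0" by (auto simp: \<alpha>_def complex_eq_iff)
  define C where "C = csqrt (1 - \<i> * of_real c) * gaussian_integral \<alpha> 0 *
    exp (\<i> * of_real (2 * pi * \<omega> * x + pi * c * x\<^sup>2 - pi * c * a\<^sup>2))"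
  have "frft \<theta> (gabor_atom x \<omega>) \<xi> = C * gabor_atom a b \<xi>" for \<xi>
  proof -
    have cases: "\<not> (\<exists>k::int. \<theta> = 2 * of_int k * pi)" "\<not> (\<exists>k::int. \<theta> = (2 * of_int k + 1) * pi)"
    proof -
      have "sin (of_int k * pi) = 0" for k :: int by (simp add: sin_zero_iff_int2)
      from this[of "2 * _"] this[of "2 * _ + 1"] False
      show "\<not> (\<exists>k::int. \<theta> = 2 * of_int k * pi)" "\<not> (\<exists>k::int. \<theta> = (2 * of_int k + 1) * pi)"
        by auto
    qed
    define \<eta> where "\<eta> = 2 * pi * (\<omega> + c * x - \<xi> / s)"
    define \<kappa> where "\<kappa> = 2 * pi * \<omega> * x + pi * c * x\<^sup>2 - 2 * pi * x * \<xi> / s"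
    define h where "h t = gabor_atom x \<omega> t * exp (of_real pi * \<i> * of_real (t\<^sup>2 * c)) *
           exp (- 2 * of_real pi * \<i> * of_real (t * \<xi> / s))" for t
    have "h (x + u) = of_real (2 powr (1/4)) * exp (\<i> * of_real \<kappa>) *
        exp (\<alpha> * of_real u ^ 2 + (\<i> * of_real \<eta>) * of_real u)" for u
    proof -
      have g: "gaussian (x + u - x) = of_real (2 powr (1/4)) * exp (of_real (- pi * u\<^sup>2))"
        unfolding exp_of_real by (simp add: gaussian_def)
      have "h (x + u) = of_real (2 powr (1/4)) * (exp (2 * of_real pi * \<i> * of_real (x + u) * of_real \<omega>) * exp (of_real (- pi * u\<^sup>2))
          * exp (of_real pi * \<i> * of_real ((x + u)\<^sup>2 * c)) * exp (- 2 * of_real pi * \<i> * of_real ((x + u) * \<xi> / s)))"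
        by (simp only: h_def modulation_def translation_def g mult_ac)
      also have "\<dots> = of_real (2 powr (1/4)) * exp (2 * of_real pi * \<i> * of_real (x + u) * of_real \<omega> + of_real (- pi * u\<^sup>2)
          + of_real pi * \<i> * of_real ((x + u)\<^sup>2 * c) + - 2 * of_real pi * \<i> * of_real ((x + u) * \<xi> / s))"
        by (simp only: exp_add mult.assoc)
      also have "2 * of_real pi * \<i> * of_real (x + u) * of_real \<omega> + of_real (- pi * u\<^sup>2)
          + of_real pi * \<i> * of_real ((x + u)\<^sup>2 * c) + - 2 * of_real pi * \<i> * of_real ((x + u) * \<xi> / s)
        = \<i> * of_real \<kappa> + (\<alpha> * of_real u ^ 2 + (\<i> * of_real \<eta>) * of_real u)"
        using s by (simp add: \<kappa>_def \<alpha>_def \<eta>_def field_simps power2_eq_square)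
      finally show ?thesis by (simp add: exp_add mult.assoc)
    qed
    then have "(LINT t|lborel. h t) = of_real (2 powr (1/4)) * exp (\<i> * of_real \<kappa>) * gaussian_integral \<alpha> \<eta>"
      using lborel_integral_real_affine[of 1 h x] by (simp add: gaussian_integral_def)
    then have "frft \<theta> (gabor_atom x \<omega>) \<xi> = csqrt (1 - \<i> * of_real c) * exp (of_real pi * \<i> * of_real (\<xi>\<^sup>2 * c)) *
       (of_real (2 powr (1/4)) * exp (\<i> * of_real \<kappa>) * (gaussian_integral \<alpha> 0 * exp (of_real \<eta> ^ 2 / (4 * \<alpha>))))"
      unfolding frft_def if_not_P[OF cases(1)] if_not_P[OF cases(2)] h_def[symmetric]
        c_def[symmetric] s_def[symmetric] gaussian_integral_eq[OF \<alpha>(1), of \<eta>] by simp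
    also have "\<dots> = csqrt (1 - \<i> * of_real c) * gaussian_integral \<alpha> 0 * (of_real (2 powr (1/4)) *
        exp (of_real pi * \<i> * of_real (\<xi>\<^sup>2 * c) + \<i> * of_real \<kappa> + of_real \<eta> ^ 2 / (4 * \<alpha>)))"
      by (simp add: exp_add)
    also have "of_real pi * \<i> * of_real (\<xi>\<^sup>2 * c) + \<i> * of_real \<kappa> + of_real \<eta> ^ 2 / (4 * \<alpha>)
      = \<i> * of_real (2 * pi * \<omega> * x + pi * c * x\<^sup>2 - pi * c * a\<^sup>2) +
        (2 * of_real pi * \<i> * of_real \<xi> * of_real b + of_real (- pi * (\<xi> - a)\<^sup>2))"
    proof -
      have "s * (\<omega> + c * x - \<xi> / s) = a * (s\<^sup>2 + c\<^sup>2 * s\<^sup>2) - \<xi>"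
        using s by (simp add: x \<omega> field_simps power2_eq_square)
      then have "s * (\<omega> + c * x - \<xi> / s) = a - \<xi>" using one by simp
      then have "\<omega> + c * x - \<xi> / s = (a - \<xi>) / s"
        using s by (metis nonzero_mult_div_cancel_left)
      then have "\<eta> = 2 * pi * (a - \<xi>) / s" by (simp add: \<eta>_def)
      then have "\<eta>\<^sup>2 = 4 * pi\<^sup>2 * (a - \<xi>)\<^sup>2 * (1 + c\<^sup>2)"
      proof -
        assume "\<eta> = 2 * pi * (a - \<xi>) / s"
        then have "\<eta>\<^sup>2 = 4 * pi\<^sup>2 * (a - \<xi>)\<^sup>2 * (1 / s\<^sup>2)"
          by (simp add: power_divide power_mult_distrib)
        also have "1 / s\<^sup>2 = 1 + c\<^sup>2" using one s by (simp add: field_simps)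
        finally show ?thesis .
      qed
      moreover have "- of_real pi * (of_real (1 + c\<^sup>2)) = \<alpha> * (1 + \<i> * of_real c)"
        by (simp add: \<alpha>_def algebra_simps power2_eq_square)
      moreover have "of_real (4 * pi\<^sup>2 * (a - \<xi>)\<^sup>2 * (1 + c\<^sup>2))
          = - 4 * of_real pi * of_real ((a - \<xi>)\<^sup>2) * (- of_real pi * (of_real (1 + c\<^sup>2)) :: complex)"
        by (simp add: power2_eq_square)
      ultimately have "of_real (\<eta>\<^sup>2) = - 4 * of_real pi * of_real ((a - \<xi>)\<^sup>2) * (\<alpha> * (1 + \<i> * of_real c))"
        by simp
      then have "of_real \<eta> ^ 2 / (4 * \<alpha>) = - of_real pi * of_real ((a - \<xi>)\<^sup>2) * (1 + \<i> * of_real c)"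
        using \<alpha>(2) by (simp add: field_simps)
      moreover have "x * \<xi> / s = a * c * \<xi> - b * \<xi>" using s by (simp add: x field_simps)
      then have "\<kappa> = 2 * pi * \<omega> * x + pi * c * x\<^sup>2 - 2 * pi * (a * c * \<xi> - b * \<xi>)"
        unfolding \<kappa>_def by (metis mult.assoc times_divide_eq_right)
      ultimately show ?thesis
        by (simp add: complex_eq_iff) (simp add: algebra_simps power2_eq_square)
    qed
    also have "csqrt (1 - \<i> * of_real c) * gaussian_integral \<alpha> 0 * (of_real (2 powr (1/4)) *
       exp (\<i> * of_real (2 * pi * \<omega> * x + pi * c * x\<^sup>2 - pi * c * a\<^sup>2) +
        (2 * of_real pi * \<i> * of_real \<xi> * of_real b + of_real (- pi * (\<xi> - a)\<^sup>2))))
      = C * gabor_atom a b \<xi>"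
    proof -
      have g: "gaussian (\<xi> - a) = of_real (2 powr (1/4)) * exp (of_real (- pi * (\<xi> - a)\<^sup>2))"
        unfolding exp_of_real by (simp add: gaussian_def)
      show ?thesis by (simp only: C_def exp_add modulation_def translation_def g mult_ac)
    qed
    finally show ?thesis .
  qed
  moreover have "C \<noteq> 0"
  proof -
    have "Re (1 - \<i> * of_real c) = 1" by simp
    then have "1 - \<i> * of_real c \<noteq> 0" by (metis zero_complex.simps(1) zero_neq_one)
    then show ?thesis unfolding C_def using gaussian_integral_nonzero[OF \<alpha>(1)] by simp
  qed
  ultimately show ?thesis by auto
qed

section \<open>Spectrograms of compactly supported functions\<close>

text \<open>
  For \<open>K(t,s) = F(t) F(s)\<^sup>*\<close> this is the autocorrelation of \<open>F\<close>, up to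
  conjugation.
\<close>

definition shear_marginal :: "(real \<times> real \<Rightarrow> complex) \<Rightarrow> real \<Rightarrow> complex" where
  "shear_marginal K u = (LINT t|lborel. K (t, t + u))"

lemma integrable_shear:
  fixes K :: "real \<times> real \<Rightarrow> complex"
  assumes K: "integrable (lborel \<Otimes>\<^sub>M lborel) K"
  shows "integrable (lborel \<Otimes>\<^sub>M lborel) (\<lambda>(t, u). K (t, t + u))"
proof (rule lborel_pair.Fubini_integrable)
  have [measurable]: "K \<in> borel_measurable (borel \<Otimes>\<^sub>M borel)"
    using borel_measurable_integrable[OF K] by simp
  show "(\<lambda>(t, u). K (t, t + u)) \<in> borel_measurable (lborel \<Otimes>\<^sub>M lborel)"
    by measurable
  have "(LINT u|lborel. cmod (K (t, t + u))) = (LINT s|lborel. cmod (K (t, s)))" for t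
    using lborel_integral_real_affine[of 1 "\<lambda>s. cmod (K (t, s))" t] by simp
  then show "integrable lborel (\<lambda>t. LINT u|lborel. cmod (case (t, u) of (t, u) \<Rightarrow> K (t, t + u)))"
    using lborel_pair.integrable_fst'[OF integrable_norm[OF K]] by simp
  show "AE t in lborel. integrable lborel (\<lambda>u. case (t, u) of (t, u) \<Rightarrow> K (t, t + u))"
    using lborel_pair.AE_integrable_fst'[OF K]
  proof eventually_elim
    case (elim t)
    then show ?case using lborel_integrable_real_affine_iff[of 1 "\<lambda>s. K (t, s)" t] by simp
  qed
qed

lemma integrable_shear_marginal:
  assumes "integrable (lborel \<Otimes>\<^sub>M lborel) K"
  shows "integrable lborel (shear_marginal K)"
  unfolding shear_marginal_def using lborel_pair.integrable_snd[OF integrable_shear[OF assms]] .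

lemma integral_shear_marginal:
  assumes K: "integrable (lborel \<Otimes>\<^sub>M lborel) K"
  shows "(LINT u|lborel. shear_marginal K u) = integral\<^sup>L (lborel \<Otimes>\<^sub>M lborel) K"
proof -
  have "(LINT u|lborel. shear_marginal K u) = (LINT t|lborel. LINT u|lborel. K (t, t + u))"
    unfolding shear_marginal_def by (rule lborel_pair.Fubini_integral[OF integrable_shear[OF K]])
  also have "\<dots> = (LINT t|lborel. LINT s|lborel. K (t, s))"
    using lborel_integral_real_affine[of 1 "\<lambda>s. K (_, s)"] by simp
  also have "\<dots> = integral\<^sup>L (lborel \<Otimes>\<^sub>M lborel) K"
    by (rule lborel_pair.integral_fst'[OF K])
  finally show ?thesis .
qed

text \<open>
  This is the change of variables \<open>(t, u) \<mapsto> (t, t + u)\<close> followed by Fubini.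
\<close>

lemma integral_shear_marginal_mult:
  assumes K: "integrable (lborel \<Otimes>\<^sub>M lborel) K"
    and m: "m \<in> borel_measurable borel" "\<And>u. cmod (m u) \<le> C"
  shows "(LINT u|lborel. shear_marginal K u * m u) = (LINT z|(lborel \<Otimes>\<^sub>M lborel). K z * m (snd z - fst z))"
proof -
  have "integrable (lborel \<Otimes>\<^sub>M lborel) (\<lambda>z. m (snd z - fst z) * K z)"
    by (rule integrable_bounded_mult[OF K, where C = C]) (use m in simp_all)
  then have "integrable (lborel \<Otimes>\<^sub>M lborel) (\<lambda>z. K z * m (snd z - fst z))"
    by (simp add: mult.commute)
  from integral_shear_marginal[OF this] show ?thesis
    by (simp add: shear_marginal_def)
qed

lemma cmod_gaussian_le: "cmod (gaussian t) \<le> 2 powr (1/4)"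
  by (simp add: gaussian_def norm_mult)

lemma gaussian_measurable [measurable]: "gaussian \<in> borel_measurable borel"
  unfolding gaussian_def[abs_def] by measurable

lemma cnj_gaussian [simp]: "cnj (gaussian t) = gaussian t"
  by (simp add: gaussian_def)

lemma gabor_atom_cis: "gabor_atom a b t = cis (2 * pi * b * t) * gaussian (t - a)"
  by (simp add: modulation_def translation_def cis_conv_exp algebra_simps)

lemma integrable_times_gabor_atom:
  assumes "integrable lborel F"
  shows "integrable lborel (\<lambda>t. F t * gabor_atom a b t)"
proof -
  have "integrable lborel (\<lambda>t. gabor_atom a b t * F t)"
    by (rule integrable_bounded_mult[OF assms, where C = "2 powr (1/4)"])
      (use schwartz_measurable[OF gabor_atom_schwartz] in simp, simp add: gabor_atom_cis norm_mult cmod_gaussian_le)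
  then show ?thesis by (simp add: mult.commute)
qed

text \<open>
  The squared modulus is the product of the integral and its conjugate, written as a double integral.
\<close>

lemma gabor_spectrogram:
  assumes F: "integrable lborel F"
  shows "of_real ((cmod (LINT t|lborel. F t * gabor_atom a b t))\<^sup>2) = (LINT z|(lborel \<Otimes>\<^sub>M lborel). F (fst z) * cnj (F (snd z)) *
      (gaussian (fst z - a) * gaussian (snd z - a)) * cis (- 2 * pi * (snd z - fst z) * b))"
proof -
  define V where "V = (LINT t|lborel. F t * gabor_atom a b t)"
  note int = integrable_times_gabor_atom[OF F, where a = a and b = b]
  have cnj_int: "integrable lborel (\<lambda>s. cnj (F s * gabor_atom a b s))"
    using int by (rule integrable_cnj)
  have "of_real ((cmod V)\<^sup>2) = V * cnj V" by (rule complex_norm_square)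
  also have "\<dots> = V * (LINT s|lborel. cnj (F s * gabor_atom a b s))"
    unfolding V_def by (simp only: Bochner_Integration.integral_cnj)
  also have "\<dots> = (LINT (t, s)|(lborel \<Otimes>\<^sub>M lborel). (F t * gabor_atom a b t) * cnj (F s * gabor_atom a b s))"
    unfolding V_def by (rule integral_tensor[OF int cnj_int, symmetric])
  also have "\<dots> = (LINT z|(lborel \<Otimes>\<^sub>M lborel). F (fst z) * cnj (F (snd z)) *
      (gaussian (fst z - a) * gaussian (snd z - a)) * cis (- 2 * pi * (snd z - fst z) * b))"
  proof (rule Bochner_Integration.integral_cong[OF refl])
    fix z :: "real \<times> real"
    have "cis (- 2 * pi * (snd z - fst z) * b) = cis (2 * pi * b * fst z) * cis (- (2 * pi * b * snd z))"
      unfolding cis_mult by (simp add: algebra_simps)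
    then show "(case z of (t, s) \<Rightarrow> (F t * gabor_atom a b t) * cnj (F s * gabor_atom a b s)) = F (fst z) * cnj (F (snd z)) *
      (gaussian (fst z - a) * gaussian (snd z - a)) * cis (- 2 * pi * (snd z - fst z) * b)"
      by (simp add: gabor_atom_cis case_prod_unfold cis_cnj)
  qed
  finally show ?thesis unfolding V_def .
qed

text \<open>
  These are the test functions: modulated Gaussians, whose Fourier transforms are real translated Gaussians up to
  one constant factor.
\<close>

lemma fourier_shifted_gaussian:
  "fourier (\<lambda>x. exp (- of_real pi * of_real x ^ 2 + (2 * of_real pi * \<i> * of_real y) * of_real x)) u
    = gaussian_integral (- of_real pi) 0 * of_real (exp (- pi * (u - y)\<^sup>2))"
proof -
  have "fourier (\<lambda>x. exp (- of_real pi * of_real x ^ 2 + (2 * of_real pi * \<i> * of_real y) * of_real x)) u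
    = gaussian_integral (- of_real pi) (2 * pi * (y - u))"
    unfolding fourier_def gaussian_integral_def
    by (simp add: exp_add[symmetric] algebra_simps)
  also have "\<dots> = gaussian_integral (- of_real pi) 0 * exp (of_real (2 * pi * (y - u)) ^ 2 / (4 * (- of_real pi)))"
    by (rule gaussian_integral_eq) simp
  also have "of_real (2 * pi * (y - u)) ^ 2 / (4 * (- of_real pi)) = (of_real (- pi * (u - y)\<^sup>2) :: complex)"
    by (simp add: power2_eq_square field_simps)
  finally show ?thesis by (simp only: exp_of_real)
qed

text \<open>
  The difference of the rank-one kernels of \<open>F\<close> and \<open>G\<close>; these kernels determine the
  functions up to a unimodular constant.
\<close>

definition gram_difference :: "(real \<Rightarrow> complex) \<Rightarrow> (real \<Rightarrow> complex) \<Rightarrow> real \<times> real \<Rightarrow> complex" where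
  "gram_difference F G = (\<lambda>(t, s). F t * cnj (F s) - G t * cnj (G s))"

lemma integrable_gram_difference:
  assumes "integrable lborel F" "integrable lborel G"
  shows "integrable (lborel \<Otimes>\<^sub>M lborel) (gram_difference F G)"
proof -
  have "integrable (lborel \<Otimes>\<^sub>M lborel) (\<lambda>z. (case z of (t, s) \<Rightarrow> F t * cnj (F s)) - (case z of (t, s) \<Rightarrow> G t * cnj (G s)))"
    using assms by (intro Bochner_Integration.integrable_diff integrable_tensor integrable_cnj)
  then show ?thesis by (simp add: gram_difference_def case_prod_unfold)
qed

text \<open>
  For fixed \<open>a\<close> the difference of the spectrograms is the Fourier transform of the shear marginal of
  the Gaussian-weighted kernel, which is supported in \<open>[-2B,2B]\<close>. Testing with
  \<open>exp(-\<pi>(u-y)^2)\<close> and expanding the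
  three squares leaves a weight independent of \<open>a\<close> and \<open>y\<close> times exponentials that are
  linear in \<open>a (t+s)\<close> and \<open>y (s-t)\<close>.
\<close>

lemma spectrogram_orthogonality:
  assumes U: "uniqueness_set_PW 1 (2 * B) X"
    and F: "integrable lborel F" "\<And>t. t \<notin> {-B..B} \<Longrightarrow> F t = 0"
    and G: "integrable lborel G" "\<And>t. t \<notin> {-B..B} \<Longrightarrow> G t = 0"
    and eq: "\<And>b. b \<in> X \<Longrightarrow> cmod (LINT t|lborel. F t * gabor_atom a b t) = cmod (LINT t|lborel. G t * gabor_atom a b t)"
  shows "(LINT z|(lborel \<Otimes>\<^sub>M lborel). gram_difference F G z *
      of_real (exp (- pi * ((fst z)\<^sup>2 + (snd z)\<^sup>2 + (snd z - fst z)\<^sup>2)) *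
        exp (2 * pi * a * (fst z + snd z) + 2 * pi * y * (snd z - fst z)))) = 0"
proof -
  define K where "K z = gram_difference F G z * (gaussian (fst z - a) * gaussian (snd z - a))" for z
  have weight: "cmod (gaussian (fst z - a) * gaussian (snd z - a)) \<le> 2 powr (1/4) * 2 powr (1/4)" for z :: "real \<times> real"
    unfolding norm_mult by (intro mult_mono cmod_gaussian_le) auto
  have bnd: "integrable (lborel \<Otimes>\<^sub>M lborel) (\<lambda>z. H z * (gaussian (fst z - a) * gaussian (snd z - a)))"
    if "integrable (lborel \<Otimes>\<^sub>M lborel) H" for H
    using integrable_bounded_mult[OF that _ weight] by (simp add: mult.commute)
  have K: "integrable (lborel \<Otimes>\<^sub>M lborel) K"
    unfolding K_def by (intro bnd integrable_gram_difference F G)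
  have cis: "(\<lambda>u. cis (- 2 * pi * u * b)) \<in> borel_measurable borel" "\<And>u. cmod (cis (- 2 * pi * u * b)) \<le> 1" for b
    by (simp_all add: cis_conv_exp)
  have "fourier (shear_marginal K) b = 0" if "b \<in> X" for b
  proof -
    have int: "integrable (lborel \<Otimes>\<^sub>M lborel) (\<lambda>z. H (fst z) * cnj (H (snd z)) *
        (gaussian (fst z - a) * gaussian (snd z - a)) * cis (- 2 * pi * (snd z - fst z) * b))"
      if "integrable lborel H" for H
    proof -
      have "integrable (lborel \<Otimes>\<^sub>M lborel) (\<lambda>z. H (fst z) * cnj (H (snd z)))"
        using integrable_tensor[OF that integrable_cnj[OF that]] by (simp add: case_prod_unfold)
      from integrable_bounded_mult[OF bnd[OF this], of "\<lambda>z. cis (- 2 * pi * (snd z - fst z) * b)" 1]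
      show ?thesis by (simp add: cis_conv_exp mult.commute)
    qed
    have "fourier (shear_marginal K) b = (LINT z|(lborel \<Otimes>\<^sub>M lborel). K z * cis (- 2 * pi * (snd z - fst z) * b))"
      unfolding fourier_cis by (rule integral_shear_marginal_mult[OF K cis])
    also have "\<dots> = of_real ((cmod (LINT t|lborel. F t * gabor_atom a b t))\<^sup>2) - of_real ((cmod (LINT t|lborel. G t * gabor_atom a b t))\<^sup>2)"
      unfolding gabor_spectrogram[OF F(1)] gabor_spectrogram[OF G(1)]
        Bochner_Integration.integral_diff[OF int[OF F(1)] int[OF G(1)], symmetric]
      by (simp add: K_def gram_difference_def case_prod_unfold algebra_simps)
    finally show ?thesis using eq[OF that] by simp
  qed
  moreover have "shear_marginal K u = 0" if "u \<notin> {-(2 * B)..2 * B}" for u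
  proof -
    have "K (t, t + u) = 0" for t
    proof (cases "t \<in> {-B..B}")
      case True
      with that have "t + u \<notin> {-B..B}" by auto
      then show ?thesis using F(2) G(2) by (simp add: K_def gram_difference_def)
    next
      case False
      then show ?thesis using F(2) G(2) by (simp add: K_def gram_difference_def)
    qed
    then show ?thesis by (simp add: shear_marginal_def)
  qed
  moreover define \<psi> where "\<psi> x = exp (- of_real pi * of_real x ^ 2 + (2 * of_real pi * \<i> * of_real y) * of_real x)" for x
  have \<psi>: "\<psi> \<in> schwartz_space"
    unfolding \<psi>_def[abs_def] by (intro complex_gaussian_schwartz) simp
  ultimately have "(LINT u|lborel. shear_marginal K u * fourier \<psi> u) = 0"
    by (intro uniqueness_set_PW_1[OF U integrable_shear_marginal[OF K]])
  then have "0 = (LINT z|(lborel \<Otimes>\<^sub>M lborel). K z * fourier \<psi> (snd z - fst z))"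
    using integral_shear_marginal_mult[OF K schwartz_measurable[OF fourier_schwartz[OF \<psi>]] fourier_bounded] by simp
  also have "\<dots> = (LINT z|(lborel \<Otimes>\<^sub>M lborel). (gaussian_integral (- of_real pi) 0 * of_real (2 powr (1/2) * exp (- 2 * pi * a\<^sup>2 - pi * y\<^sup>2))) *
      (gram_difference F G z *
      of_real (exp (- pi * ((fst z)\<^sup>2 + (snd z)\<^sup>2 + (snd z - fst z)\<^sup>2)) *
        exp (2 * pi * a * (fst z + snd z) + 2 * pi * y * (snd z - fst z)))))"
  proof (rule Bochner_Integration.integral_cong[OF refl])
    fix z :: "real \<times> real"
    obtain t s where z: "z = (t, s)" by fastforce
    have regroup: "k * (p * q) * (i * e) = (i * c) * (k * w)" if "p * q * e = c * w" for k p q i e c w :: complex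
    proof -
      have "k * (p * q) * (i * e) = k * i * (p * q * e)" by (simp only: mult_ac)
      then show ?thesis unfolding that by (simp only: mult_ac)
    qed
    have "2 powr (1/4) * exp (- pi * (t - a)\<^sup>2) * (2 powr (1/4) * exp (- pi * (s - a)\<^sup>2)) * exp (- pi * (s - t - y)\<^sup>2)
      = (2 powr (1/4) * 2 powr (1/4)) * exp (- pi * (t - a)\<^sup>2 + - pi * (s - a)\<^sup>2 + - pi * (s - t - y)\<^sup>2)"
      by (simp only: exp_add mult_ac)
    also have "2 powr (1/4) * 2 powr (1/4) = (2 powr (1/2) :: real)"
      by (simp flip: powr_add)
    also have "- pi * (t - a)\<^sup>2 + - pi * (s - a)\<^sup>2 + - pi * (s - t - y)\<^sup>2
      = (- 2 * pi * a\<^sup>2 - pi * y\<^sup>2) + - pi * (t\<^sup>2 + s\<^sup>2 + (s - t)\<^sup>2) + (2 * pi * a * (t + s) + 2 * pi * y * (s - t))"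
      by (simp add: power2_eq_square algebra_simps)
    finally have "2 powr (1/4) * exp (- pi * (t - a)\<^sup>2) * (2 powr (1/4) * exp (- pi * (s - a)\<^sup>2)) * exp (- pi * (s - t - y)\<^sup>2)
      = 2 powr (1/2) * exp (- 2 * pi * a\<^sup>2 - pi * y\<^sup>2) * (exp (- pi * (t\<^sup>2 + s\<^sup>2 + (s - t)\<^sup>2)) * exp (2 * pi * a * (t + s) + 2 * pi * y * (s - t)))"
      by (simp only: exp_add mult.assoc)
    from arg_cong[OF this, of complex_of_real]
    have "gaussian (t - a) * gaussian (s - a) * of_real (exp (- pi * (s - t - y)\<^sup>2)) =
       of_real (2 powr (1/2) * exp (- 2 * pi * a\<^sup>2 - pi * y\<^sup>2)) * of_real (exp (- pi * (t\<^sup>2 + s\<^sup>2 + (s - t)\<^sup>2)) * exp (2 * pi * a * (t + s) + 2 * pi * y * (s - t)))"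
      unfolding gaussian_def of_real_mult .
    then show "K z * fourier \<psi> (snd z - fst z) = (gaussian_integral (- of_real pi) 0 * of_real (2 powr (1/2) * exp (- 2 * pi * a\<^sup>2 - pi * y\<^sup>2))) *
      (gram_difference F G z *
      of_real (exp (- pi * ((fst z)\<^sup>2 + (snd z)\<^sup>2 + (snd z - fst z)\<^sup>2)) *
        exp (2 * pi * a * (fst z + snd z) + 2 * pi * y * (snd z - fst z))))"
      unfolding \<psi>_def[abs_def] fourier_shifted_gaussian K_def z fst_conv snd_conv
      by (rule regroup)
  qed
  finally show ?thesis
    using gaussian_integral_nonzero[of "- of_real pi"] by (subst (asm) integral_mult_right_zero) simp
qed

section \<open>A quantitative Muntz theorem for exponentials\<close>

text \<open>
  \<open>R\<close> solves \<open>R' + l R = (l - q) P\<close>, so \<open>R(s) = (l - q)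
  \<integral>\<^sub>0\<^sup>s P(u) exp(-l(s-u)) du\<close>, and the
  total mass of the kernel is at most \<open>1/l\<close>. The bound is read off the differential equation by
  monotonicity of \<open>(c \<mp> R) exp(ls)\<close>.
\<close>

lemma exponential_smoothing_step:
  fixes P R :: "real \<Rightarrow> real"
  assumes l: "l > q" "q > 0"
    and R: "\<And>s. (R has_real_derivative (l - q) * P s - l * R s) (at s)" "R 0 = 0"
    and P: "\<And>s. s \<ge> 0 \<Longrightarrow> \<bar>P s\<bar> \<le> M"
    and s: "s \<ge> 0"
  shows "\<bar>R s\<bar> \<le> (1 - q / l) * M"
proof -
  have lpos: "l > 0" using l by linarith
  have M: "M \<ge> 0" using P[of 0] by linarith
  define c where "c = (1 - q / l) * M"
  have c: "c * l = (l - q) * M" using lpos by (simp add: c_def field_simps)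
  have upper: "\<sigma> * R s \<le> c" if \<sigma>: "\<sigma> = 1 \<or> \<sigma> = -1" for \<sigma> :: real
  proof -
    \<comment> \<open>The case \<open>\<sigma> = -1\<close> gives the lower bound on \<open>R\<close>.\<close>
    define g where "g u = (c - \<sigma> * R u) * exp (l * u)" for u
    have "(g has_real_derivative ((l - q) * (M - \<sigma> * P u)) * exp (l * u)) (at u)" for u
    proof -
      have "(g has_real_derivative (0 - \<sigma> * ((l - q) * P u - l * R u)) * exp (l * u)
          + (l * exp (l * u)) * (c - \<sigma> * R u)) (at u)"
        unfolding g_def by (rule derivative_eq_intros R(1) refl | simp add: mult.commute)+
      also have "(0 - \<sigma> * ((l - q) * P u - l * R u)) * exp (l * u) + (l * exp (l * u)) * (c - \<sigma> * R u)
        = (c * l - \<sigma> * ((l - q) * P u)) * exp (l * u)"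
        by (simp add: algebra_simps)
      also have "c * l - \<sigma> * ((l - q) * P u) = (l - q) * (M - \<sigma> * P u)"
        unfolding c by (simp add: algebra_simps)
      finally show ?thesis .
    qed
    moreover have "((l - q) * (M - \<sigma> * P u)) * exp (l * u) \<ge> 0" if "u \<ge> 0" for u
      using P[OF that] l \<sigma> by (intro mult_nonneg_nonneg) auto
    ultimately have "g 0 \<le> g s"
      using s by (intro DERIV_nonneg_imp_nondecreasing[of 0 s g]) blast+
    moreover have "g 0 \<ge> 0" using R(2) l M lpos by (simp add: g_def c_def)
    ultimately have "0 \<le> (c - \<sigma> * R s) * exp (l * s)" by (simp add: g_def)
    then show ?thesis by (simp add: zero_le_mult_iff)
  qed
  from upper[of 1] upper[of "-1"] show ?thesis by (simp add: c_def abs_le_iff)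
qed

text \<open>
  Von Golitschek's proof of the Muntz theorem after the substitution \<open>x = exp(-s)\<close>. If
  \<open>P\<close> is the error of an approximation with exponents in \<open>L\<close>, then the smoothing step
  turns it into the error \<open>R\<close> of an approximation with the additional exponent \<open>l\<close>, and
  multiplies the bound by \<open>1 - q/l\<close>.
\<close>

lemma muntz_approximation:
  fixes q :: real
  assumes "finite L" "q > 0" "\<And>l. l \<in> L \<Longrightarrow> l > q"
  shows "\<exists>c. \<forall>s\<ge>0. \<bar>exp (- q * s) - (\<Sum>l\<in>L. c l * exp (- l * s))\<bar> \<le> (\<Prod>l\<in>L. 1 - q / l)"
  using assms(1,3)
proof (induction L rule: finite_induct)
  case empty
  then show ?case using \<open>q > 0\<close> by auto
next
  case (insert l L)
  then obtain c where c: "\<And>s. s \<ge> 0 \<Longrightarrow>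
      \<bar>exp (- q * s) - (\<Sum>m\<in>L. c m * exp (- m * s))\<bar> \<le> (\<Prod>m\<in>L. 1 - q / m)"
    by blast
  have l: "l > q" using insert.prems by simp
  define P where "P s = exp (- q * s) - (\<Sum>m\<in>L. c m * exp (- m * s))" for s
  \<comment> \<open>The coefficients come from integrating \<open>(l - q) P(u) exp(-l(s-u))\<close> over \<open>[0,s]\<close> term by term.\<close>
  define d where "d m = (l - q) * c m / (l - m)" for m
  define R where "R s = exp (- q * s) - exp (- l * s) - (\<Sum>m\<in>L. d m * (exp (- m * s) - exp (- l * s)))" for s
  have ne: "l - m \<noteq> 0" if "m \<in> L" for m using insert.hyps that by auto
  have deriv: "(R has_real_derivative (l - q) * P s - l * R s) (at s)" for s
  proof -
    have "(R has_real_derivative - q * exp (- q * s) + l * exp (- l * s)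
        - (\<Sum>m\<in>L. d m * (- m * exp (- m * s) + l * exp (- l * s)))) (at s)"
      unfolding R_def by (auto intro!: derivative_eq_intros simp: algebra_simps)
    also have "- q * exp (- q * s) + l * exp (- l * s)
        - (\<Sum>m\<in>L. d m * (- m * exp (- m * s) + l * exp (- l * s))) + l * R s
        = (l - q) * exp (- q * s) - (\<Sum>m\<in>L. (l - q) * (c m * exp (- m * s)))"
    proof -
      have "(l - q) * (c m * exp (- m * s)) = d m * (- m * exp (- m * s) + l * exp (- l * s)) + l * (d m * (exp (- m * s) - exp (- l * s)))"
        if "m \<in> L" for m
      proof -
        have "d m * (- m * exp (- m * s) + l * exp (- l * s)) + l * (d m * (exp (- m * s) - exp (- l * s)))
          = (d m * (l - m)) * exp (- m * s)"
          by (simp add: algebra_simps)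
        also have "d m * (l - m) = (l - q) * c m" using ne[OF that] by (simp add: d_def)
        finally show ?thesis by simp
      qed
      then have "(\<Sum>m\<in>L. (l - q) * (c m * exp (- m * s))) = (\<Sum>m\<in>L. d m * (- m * exp (- m * s) + l * exp (- l * s)))
         + l * (\<Sum>m\<in>L. d m * (exp (- m * s) - exp (- l * s)))"
        by (simp add: sum.distrib sum_distrib_left)
      then show ?thesis unfolding R_def by (simp add: algebra_simps)
    qed
    then have "- q * exp (- q * s) + l * exp (- l * s)
        - (\<Sum>m\<in>L. d m * (- m * exp (- m * s) + l * exp (- l * s))) = (l - q) * P s - l * R s"
      by (simp add: P_def right_diff_distrib sum_distrib_left)
    finally show ?thesis .
  qed
  have bound: "\<bar>R s\<bar> \<le> (1 - q / l) * (\<Prod>m\<in>L. 1 - q / m)" if "s \<ge> 0" for s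
    by (rule exponential_smoothing_step[OF l \<open>q > 0\<close> deriv]) (use c that in \<open>auto simp: R_def P_def\<close>)
  define c' where "c' m = (if m = l then 1 - (\<Sum>m\<in>L. d m) else d m)" for m
  have "exp (- q * s) - (\<Sum>m\<in>insert l L. c' m * exp (- m * s)) = R s" for s
  proof -
    have "(\<Sum>m\<in>L. c' m * exp (- m * s)) = (\<Sum>m\<in>L. d m * exp (- m * s))"
      using insert.hyps by (intro sum.cong) (auto simp: c'_def)
    then show ?thesis
      using insert.hyps by (simp add: R_def c'_def right_diff_distrib sum_subtractf sum_distrib_right left_diff_distrib)
  qed
  then show ?case
    using bound insert.hyps by (intro exI[of _ c']) simp
qed

lemma prod_one_minus_le_exp:
  fixes q :: real
  assumes "\<And>l. l \<in> L \<Longrightarrow> l > q" "q > 0"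
  shows "(\<Prod>l\<in>L. 1 - q / l) \<le> exp (- q * (\<Sum>l\<in>L. 1 / l))"
proof (cases "finite L")
  case True
  have "(\<Prod>l\<in>L. 1 - q / l) \<le> (\<Prod>l\<in>L. exp (- q / l))"
  proof (rule prod_mono)
    fix l assume "l \<in> L"
    then have "l > q" "l > 0" using assms by fastforce+
    then show "0 \<le> 1 - q / l \<and> 1 - q / l \<le> exp (- q / l)"
      using exp_ge_add_one_self[of "- q / l"] by (auto simp: field_simps)
  qed
  also have "\<dots> = exp (- q * (\<Sum>l\<in>L. 1 / l))"
    by (simp add: exp_sum[OF True, symmetric] sum_distrib_left sum_negf)
  finally show ?thesis .
qed simp

lemma not_summable_imp_large_sums:
  fixes f :: "'a \<Rightarrow> real"
  assumes "\<not> f summable_on A" "\<And>x. x \<in> A \<Longrightarrow> f x \<ge> 0"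
  obtains L where "finite L" "L \<subseteq> A" "sum f L > C"
proof -
  have "\<not> eventually (\<lambda>L. sum f L \<le> C) (finite_subsets_at_top A)"
    using assms nonneg_bounded_partial_sums_imp_summable_on by blast
  then obtain L where "finite L" "L \<subseteq> A" "\<not> sum f L \<le> C"
    unfolding eventually_finite_subsets_at_top by blast
  then show ?thesis using that by force
qed

text \<open>
  Subtracting a combination of the vanishing integrals replaces \<open>exp(-qs)\<close> by the
  approximation error, which is at most \<open>exp(-qC)\<close> once the reciprocals of the
  exponents used sum to more than \<open>C\<close>.
\<close>

lemma muntz_vanishing:
  fixes H :: "'a \<Rightarrow> complex" and s :: "'a \<Rightarrow> real"
  assumes H: "integrable M H" and s: "s \<in> borel_measurable M" "\<And>z. s z \<ge> 0"
    and "q > 0" "\<And>l. l \<in> L \<Longrightarrow> l > q"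
    and div: "\<not> (\<lambda>l. 1 / l) summable_on L"
    and zero: "\<And>l. l \<in> L \<Longrightarrow> (\<integral>z. H z * of_real (exp (- l * s z)) \<partial>M) = 0"
  shows "(\<integral>z. H z * of_real (exp (- q * s z)) \<partial>M) = 0"
proof -
  have pos: "l > 0" if "l \<in> L" for l using assms(4) assms(5)[OF that] by linarith
  define N where "N = (\<integral>z. cmod (H z) \<partial>M)"
  have N: "N \<ge> 0" by (simp add: N_def)
  have int: "integrable M (\<lambda>z. H z * of_real (exp (- l * s z)))" if "l > 0" for l
  proof -
    have "integrable M (\<lambda>z. of_real (exp (- l * s z)) * H z)"
      by (rule integrable_bounded_mult[OF H, where C = 1]) (use s that in auto)
    then show ?thesis by (simp add: mult.commute)
  qed
  have "cmod (\<integral>z. H z * of_real (exp (- q * s z)) \<partial>M) \<le> exp (- q * C) * N" for C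
  proof -
    obtain A where A: "finite A" "A \<subseteq> L" "(\<Sum>l\<in>A. 1 / l) > C"
      using not_summable_imp_large_sums[OF div] pos by (metis less_imp_le zero_le_divide_1_iff)
    obtain c where c: "\<And>t. t \<ge> 0 \<Longrightarrow> \<bar>exp (- q * t) - (\<Sum>l\<in>A. c l * exp (- l * t))\<bar> \<le> (\<Prod>l\<in>A. 1 - q / l)"
      using muntz_approximation[OF A(1) \<open>q > 0\<close>] assms(5) A(2) by (metis subsetD)
    have small: "(\<Prod>l\<in>A. 1 - q / l) \<le> exp (- q * C)"
    proof (rule order.trans[OF prod_one_minus_le_exp])
      show "exp (- q * (\<Sum>l\<in>A. 1 / l)) \<le> exp (- q * C)" using A(3) \<open>q > 0\<close> by simp
    qed (use A assms(4,5) in auto)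
    have "(\<integral>z. H z * of_real (\<Sum>l\<in>A. c l * exp (- l * s z)) \<partial>M) = (\<Sum>l\<in>A. of_real (c l) * (\<integral>z. H z * of_real (exp (- l * s z)) \<partial>M))"
    proof -
      have "(\<integral>z. H z * of_real (\<Sum>l\<in>A. c l * exp (- l * s z)) \<partial>M) = (\<integral>z. (\<Sum>l\<in>A. of_real (c l) * (H z * of_real (exp (- l * s z)))) \<partial>M)"
        by (simp add: sum_distrib_left mult_ac)
      also have "\<dots> = (\<Sum>l\<in>A. \<integral>z. of_real (c l) * (H z * of_real (exp (- l * s z))) \<partial>M)"
        using int pos A(2) by (intro Bochner_Integration.integral_sum) auto
      finally show ?thesis by simp
    qed
    also have "\<dots> = 0" using zero A(2) by (intro sum.neutral) auto
    finally have comb: "(\<integral>z. H z * of_real (\<Sum>l\<in>A. c l * exp (- l * s z)) \<partial>M) = 0" .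
    have comb_int: "integrable M (\<lambda>z. H z * of_real (\<Sum>l\<in>A. c l * exp (- l * s z)))"
    proof -
      have "integrable M (\<lambda>z. \<Sum>l\<in>A. of_real (c l) * (H z * of_real (exp (- l * s z))))"
        using int pos A(2) by (intro Bochner_Integration.integrable_sum integrable_mult_right) auto
      then show ?thesis by (simp add: sum_distrib_left mult_ac)
    qed
    have "(\<integral>z. H z * of_real (exp (- q * s z)) \<partial>M)
        = (\<integral>z. H z * of_real (exp (- q * s z) - (\<Sum>l\<in>A. c l * exp (- l * s z))) \<partial>M)"
      using Bochner_Integration.integral_diff[OF int[OF \<open>q > 0\<close>] comb_int] comb
      by (simp add: right_diff_distrib)
    also have "cmod \<dots> \<le> (\<integral>z. cmod (H z * of_real (exp (- q * s z) - (\<Sum>l\<in>A. c l * exp (- l * s z)))) \<partial>M)"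
      by (rule integral_norm_bound)
    also have "\<dots> \<le> (\<integral>z. cmod (H z) * exp (- q * C) \<partial>M)"
    proof (rule integral_mono)
      show "integrable M (\<lambda>z. cmod (H z * of_real (exp (- q * s z) - (\<Sum>l\<in>A. c l * exp (- l * s z)))))"
        using Bochner_Integration.integrable_diff[OF int[OF \<open>q > 0\<close>] comb_int]
        by (intro integrable_norm) (simp add: right_diff_distrib)
      show "cmod (H z * of_real (exp (- q * s z) - (\<Sum>l\<in>A. c l * exp (- l * s z)))) \<le> cmod (H z) * exp (- q * C)" for z
        unfolding norm_mult norm_of_real
        by (intro mult_left_mono order.trans[OF c small] s) auto
    qed (use H in auto)
    finally show ?thesis by (simp add: N_def mult.commute)
  qed
  moreover have "((\<lambda>C. exp (- q * C) * N) \<longlongrightarrow> 0 * N) at_top"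
    using \<open>q > 0\<close>
    by (intro tendsto_mult tendsto_const filterlim_compose[OF exp_at_bot]
        filterlim_tendsto_neg_mult_at_bot[OF tendsto_const _ filterlim_ident]) auto
  ultimately have "cmod (\<integral>z. H z * of_real (exp (- q * s z)) \<partial>M) \<le> 0 * N"
    by (intro tendsto_lowerbound[where F = at_top]) auto
  then show ?thesis by simp
qed

section \<open>Completeness of exponential moments\<close>

text \<open>
  If \<open>A\<close> has infinitely many elements below \<open>1\<close>, the shifted reciprocals contain
  infinitely many terms of size at least \<open>1/(1 + r)\<close>; otherwise the divergence comes from \<open>x
  \<ge> 1\<close>, where \<open>1/x\<close> and \<open>1/(x + r)\<close> are comparable.
\<close>

lemma not_summable_inverse_shift:
  fixes r :: real
  assumes pos: "\<And>x. x \<in> A \<Longrightarrow> x > 0" and div: "\<not> (\<lambda>x. 1 / x) summable_on A" and r: "r \<ge> 0"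
  shows "\<not> (\<lambda>x. 1 / (x + r)) summable_on A"
proof
  assume sum: "(\<lambda>x. 1 / (x + r)) summable_on A"
  have "finite {x \<in> A. x < 1}"
  proof (rule ccontr)
    assume inf: "infinite {x \<in> A. x < 1}"
    obtain n :: nat where n: "real n * (1 / (1 + r)) > infsum (\<lambda>x. 1 / (x + r)) A"
      using reals_Archimedean3[of "1 / (1 + r)"] r by (auto simp: add_pos_nonneg)
    obtain T where T: "T \<subseteq> {x \<in> A. x < 1}" "finite T" "card T = n"
      using infinite_arbitrarily_large[OF inf] by blast
    have "real n * (1 / (1 + r)) = (\<Sum>x\<in>T. 1 / (1 + r))" using T by simp
    also have "\<dots> \<le> (\<Sum>x\<in>T. 1 / (x + r))"
      using T pos r by (intro sum_mono frac_le) (auto intro: add_pos_nonneg)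
    also have "\<dots> \<le> infsum (\<lambda>x. 1 / (x + r)) A"
      using T pos r by (intro finite_sum_le_infsum sum) (auto simp: less_imp_le)
    finally show False using n by simp
  qed
  then have small: "(\<lambda>x. 1 / x) summable_on {x \<in> A. x < 1}" by simp
  have "(\<lambda>x. (1 + r) * (1 / (x + r))) summable_on {x \<in> A. x \<ge> 1}"
    by (rule summable_on_cmult_right, rule summable_on_subset_banach[OF sum]) auto
  then have large: "(\<lambda>x. 1 / x) summable_on {x \<in> A. x \<ge> 1}"
  proof (rule summable_on_comparison_test)
    fix x assume "x \<in> {x \<in> A. x \<ge> 1}"
    then have "x \<ge> 1" by simp
    then have "x + r \<le> (1 + r) * x" using r mult_left_mono[of 1 x r] by (simp add: algebra_simps)
    then show "1 / x \<le> (1 + r) * (1 / (x + r))"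
      using \<open>x \<ge> 1\<close> r by (simp add: field_simps)
  qed auto
  have "A = {x \<in> A. x < 1} \<union> {x \<in> A. x \<ge> 1}" by auto
  with summable_on_Un_disjoint[OF small large] div show False by force
qed

text \<open>
  Since \<open>v\<close> is bounded where \<open>H \<noteq> 0\<close>, one may put \<open>s = c - v \<ge>
  0\<close> and multiply \<open>H\<close> by
  \<open>exp((\<kappa>+1)s)\<close>. The exponents become \<open>\<omega> +
  \<kappa> + 1\<close>, all larger than \<open>q = 1\<close>, and the conclusion for \<open>q\<close> is the claim
  for \<open>-\<kappa>\<close>. The shift also copes with exponents that accumulate at \<open>0\<close>.
\<close>

lemma exponential_moments_vanish:
  fixes H :: "'a \<Rightarrow> complex" and v :: "'a \<Rightarrow> real"
  assumes pos: "\<And>\<omega>. \<omega> \<in> \<Omega> \<Longrightarrow> \<omega> > 0" and div: "\<not> (\<lambda>\<omega>. 1 / \<omega>) summable_on \<Omega>"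
    and H: "integrable M H" and v [measurable]: "v \<in> borel_measurable M"
    and supp: "\<And>z. H z \<noteq> 0 \<Longrightarrow> \<bar>v z\<bar> \<le> c"
    and zero: "\<And>\<omega>. \<omega> \<in> \<Omega> \<Longrightarrow> (\<integral>z. H z * of_real (exp (\<omega> * v z)) \<partial>M) = 0"
    and "\<kappa> \<ge> 0"
  shows "(\<integral>z. H z * of_real (exp (- \<kappa> * v z)) \<partial>M) = 0"
proof -
  \<comment> \<open>The maximum only matters where \<open>H\<close> vanishes.\<close>
  define s where "s z = max 0 (c - v z)" for z
  have s: "s z = c - v z" "s z \<le> 2 * c" if "H z \<noteq> 0" for z
    using supp[OF that] by (auto simp: s_def)
  have [measurable]: "s \<in> borel_measurable M" unfolding s_def by measurable
  define H' where "H' z = H z * of_real (exp ((\<kappa> + 1) * s z))" for z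
  have H': "integrable M H'"
  proof (rule Bochner_Integration.integrable_bound)
    show "integrable M (\<lambda>z. of_real (exp ((\<kappa> + 1) * (2 * c))) * H z)" using H by simp
    show "H' \<in> borel_measurable M" using H unfolding H'_def by measurable
    have "cmod (H' z) \<le> exp ((\<kappa> + 1) * (2 * c)) * cmod (H z)" for z
    proof (cases "H z = 0")
      case False
      have "(\<kappa> + 1) * s z \<le> (\<kappa> + 1) * (2 * c)"
        using s(2)[OF False] \<open>\<kappa> \<ge> 0\<close> by (intro mult_left_mono) auto
      then show ?thesis by (simp add: H'_def norm_mult mult.commute[of _ "cmod (H z)"] mult_left_mono)
    qed (simp add: H'_def)
    then show "AE z in M. norm (H' z) \<le> norm (of_real (exp ((\<kappa> + 1) * (2 * c))) * H z)"
      by (simp add: norm_mult)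
  qed
  have shift: "(\<integral>z. H' z * of_real (exp (- l * s z)) \<partial>M)
      = of_real (exp ((\<kappa> + 1 - l) * c)) * (\<integral>z. H z * of_real (exp ((l - (\<kappa> + 1)) * v z)) \<partial>M)" for l
  proof -
    have "H' z * of_real (exp (- l * s z)) = of_real (exp ((\<kappa> + 1 - l) * c)) * (H z * of_real (exp ((l - (\<kappa> + 1)) * v z)))" for z
    proof (cases "H z = 0")
      case False
      have "exp ((\<kappa> + 1) * s z) * exp (- l * s z) = exp ((\<kappa> + 1 - l) * c) * exp ((l - (\<kappa> + 1)) * v z)"
        unfolding exp_add[symmetric] s(1)[OF False] by (simp add: algebra_simps)
      then have "complex_of_real (exp ((\<kappa> + 1) * s z)) * of_real (exp (- l * s z)) = of_real (exp ((\<kappa> + 1 - l) * c)) * of_real (exp ((l - (\<kappa> + 1)) * v z))"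
        unfolding of_real_mult[symmetric] by simp
      then show ?thesis by (simp only: H'_def mult.assoc mult.left_commute[of "H z"])
    qed (simp add: H'_def)
    then show ?thesis by simp
  qed
  have "(\<integral>z. H' z * of_real (exp (- 1 * s z)) \<partial>M) = 0"
  proof (rule muntz_vanishing[OF H'])
    show "\<not> (\<lambda>l. 1 / l) summable_on (\<lambda>\<omega>. \<omega> + (\<kappa> + 1)) ` \<Omega>"
      using not_summable_inverse_shift[OF pos div, of "\<kappa> + 1"] \<open>\<kappa> \<ge> 0\<close>
      by (subst summable_on_reindex) (auto simp: comp_def)
  next
    fix l assume "l \<in> (\<lambda>\<omega>. \<omega> + (\<kappa> + 1)) ` \<Omega>"
    then obtain \<omega> where "\<omega> \<in> \<Omega>" "l = \<omega> + (\<kappa> + 1)" by blast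
    then show "l > 1" "(\<integral>z. H' z * of_real (exp (- l * s z)) \<partial>M) = 0"
      unfolding shift using pos zero \<open>\<kappa> \<ge> 0\<close> by (auto simp: add_pos_nonneg)
  qed (auto simp: s_def)
  then show ?thesis unfolding shift by simp
qed

lemma divergent_half_line:
  fixes \<Omega> :: "real set"
  assumes div: "\<not> (\<lambda>\<omega>. 1 / \<bar>\<omega>\<bar>) summable_on (\<Omega> - {0})"
  obtains \<sigma> :: real where "\<sigma> = 1 \<or> \<sigma> = -1"
    and "\<not> (\<lambda>\<omega>. 1 / \<omega>) summable_on {\<omega>. \<omega> > 0 \<and> \<sigma> * \<omega> \<in> \<Omega>}"
proof -
  let ?P = "{\<omega>. \<omega> > 0 \<and> 1 * \<omega> \<in> \<Omega>}" and ?N = "{\<omega>. \<omega> > 0 \<and> - 1 * \<omega> \<in> \<Omega>}"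
  have split: "\<Omega> - {0} = ?P \<union> uminus ` ?N"
    by (auto simp: image_iff) (metis add.inverse_inverse linorder_neqE_linordered_idom neg_0_less_iff_less)
  have "\<not> (\<lambda>\<omega>. 1 / \<omega>) summable_on ?P \<or> \<not> (\<lambda>\<omega>. 1 / \<omega>) summable_on ?N"
  proof (rule ccontr)
    assume "\<not> (\<not> (\<lambda>\<omega>. 1 / \<omega>) summable_on ?P \<or> \<not> (\<lambda>\<omega>. 1 / \<omega>) summable_on ?N)"
    then have *: "(\<lambda>\<omega>. 1 / \<omega>) summable_on ?P" "(\<lambda>\<omega>. 1 / \<omega>) summable_on ?N" by auto
    have "(\<lambda>\<omega>. 1 / \<bar>\<omega>\<bar>) summable_on ?P"
      using *(1) by (rule summable_on_cong[THEN iffD1, rotated]) auto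
    moreover have "(\<lambda>\<omega>. 1 / \<bar>\<omega>\<bar>) summable_on uminus ` ?N"
      unfolding summable_on_reindex[OF inj_on_subset[OF inj_uminus subset_UNIV]]
      using *(2) by (rule summable_on_cong[THEN iffD1, rotated]) auto
    ultimately have "(\<lambda>\<omega>. 1 / \<bar>\<omega>\<bar>) summable_on (?P \<union> uminus ` ?N)"
      by (rule summable_on_Un_disjoint) auto
    with div split show False by simp
  qed
  then show ?thesis using that[of 1] that[of "- 1"] by blast
qed

text \<open>
  The sign of \<open>\<sigma>\<close> selects the half-line of exponents of \<open>t + s\<close> on which the
  Muntz argument is available; the exponents of \<open>s - t\<close> are arbitrary.
\<close>

inductive exponential_sum :: "real \<Rightarrow> (real \<times> real \<Rightarrow> real) \<Rightarrow> bool" for \<sigma> where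
  monomial: "\<kappa> \<ge> 0 \<Longrightarrow> exponential_sum \<sigma> (\<lambda>z. c * exp (\<kappa> * (\<sigma> * (fst z + snd z)) + y * (snd z - fst z)))"
| add: "exponential_sum \<sigma> f \<Longrightarrow> exponential_sum \<sigma> g \<Longrightarrow> exponential_sum \<sigma> (\<lambda>z. f z + g z)"

text \<open>
  Closure under products is the reason for allowing all \<open>\<kappa> \<ge> 0\<close> and all \<open>y\<close>:
  the exponents form an additive semigroup.
\<close>

lemma exponential_sum_mult:
  assumes "exponential_sum \<sigma> f" "exponential_sum \<sigma> g"
  shows "exponential_sum \<sigma> (\<lambda>z. f z * g z)"
  using assms(1)
proof induction
  case f: (monomial \<kappa> c y)
  from assms(2) show ?case
  proof induction
    case g: (monomial \<kappa>' c' y')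
    have eq: "(\<kappa> + \<kappa>') * (\<sigma> * (fst z + snd z)) + (y + y') * (snd z - fst z)
      = (\<kappa> * (\<sigma> * (fst z + snd z)) + y * (snd z - fst z)) + (\<kappa>' * (\<sigma> * (fst z + snd z)) + y' * (snd z - fst z))"
      for z :: "real \<times> real"
      by (simp add: algebra_simps)
    have "(\<lambda>z. c * exp (\<kappa> * (\<sigma> * (fst z + snd z)) + y * (snd z - fst z)) *
        (c' * exp (\<kappa>' * (\<sigma> * (fst z + snd z)) + y' * (snd z - fst z))))
      = (\<lambda>z. c * c' * exp ((\<kappa> + \<kappa>') * (\<sigma> * (fst z + snd z)) + (y + y') * (snd z - fst z)))"
      unfolding eq exp_add[of "\<kappa> * _ + _"] by (simp only: mult_ac)
    then show ?case using exponential_sum.monomial[of "\<kappa> + \<kappa>'"] f g by simp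
  next
    case (add g h)
    then show ?case using exponential_sum.add by (simp add: distrib_left)
  qed
next
  case (add f h)
  then show ?case using exponential_sum.add by (simp add: distrib_right)
qed

lemma exponential_sum_continuous:
  "exponential_sum \<sigma> f \<Longrightarrow> continuous_on S f"
  by (induction rule: exponential_sum.induct) (auto intro!: continuous_intros)

lemma exponential_sum_approximation:
  assumes \<sigma>: "\<sigma> \<noteq> 0" and S: "compact S" and f: "continuous_on S f" and "e > 0"
  shows "\<exists>g. exponential_sum \<sigma> g \<and> (\<forall>z\<in>S. \<bar>f z - g z\<bar> < e)"
proof (rule Stone_Weierstrass_HOL[OF S _ _ _ _ _ f \<open>e > 0\<close>])
  show "exponential_sum \<sigma> (\<lambda>z. c)" for c
    using exponential_sum.monomial[of 0 \<sigma> c 0] by simp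
  fix z w :: "real \<times> real"
  assume "z \<in> S \<and> w \<in> S \<and> z \<noteq> w"
  then consider "fst z + snd z \<noteq> fst w + snd w" | "snd z - fst z \<noteq> snd w - fst w"
    unfolding prod_eq_iff by (smt (verit))
  then show "\<exists>f. exponential_sum \<sigma> f \<and> f z \<noteq> f w"
  proof cases
    case 1
    then show ?thesis using exponential_sum.monomial[of 1 \<sigma> 1 0] \<sigma>
      by (intro exI[of _ "\<lambda>z. exp (\<sigma> * (fst z + snd z))"]) simp
  next
    case 2
    then show ?thesis using exponential_sum.monomial[of 0 \<sigma> 1 1]
      by (intro exI[of _ "\<lambda>z. exp (snd z - fst z)"]) simp
  qed
qed (auto intro: exponential_sum_continuous exponential_sum.add exponential_sum_mult)

text \<open>
  Exponential sums are uniformly dense in the continuous functions on the compact set \<open>S\<close>, and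
  \<open>H\<close> vanishes outside \<open>S\<close>.
\<close>

lemma integral_continuous_eq_0:
  fixes H :: "real \<times> real \<Rightarrow> complex"
  assumes H: "integrable lborel H" and S: "compact S" and supp: "\<And>z. z \<notin> S \<Longrightarrow> H z = 0"
    and \<sigma>: "\<sigma> \<noteq> 0"
    and zero: "\<And>\<kappa> y. \<kappa> \<ge> 0 \<Longrightarrow> (\<integral>z. H z * of_real (exp (\<kappa> * (\<sigma> * (fst z + snd z)) + y * (snd z - fst z))) \<partial>lborel) = 0"
    and f: "continuous_on UNIV f"
  shows "(\<integral>z. H z * of_real (f z) \<partial>lborel) = 0"
proof -
  have int: "integrable lborel (\<lambda>z. H z * of_real (g z))" if g: "continuous_on UNIV g" for g
  proof -
    have "compact (g ` S)" using S g compact_continuous_image continuous_on_subset by blast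
    then obtain C where C: "\<And>z. z \<in> S \<Longrightarrow> \<bar>g z\<bar> \<le> C"
      using compact_imp_bounded bounded_real by (metis imageI)
    show ?thesis
    proof (rule Bochner_Integration.integrable_bound)
      show "integrable lborel (\<lambda>z. of_real C * H z)" using H by simp
      have "g \<in> borel_measurable lborel" using g by (simp add: borel_measurable_continuous_onI)
      then show "(\<lambda>z. H z * of_real (g z)) \<in> borel_measurable lborel" using H by measurable
      have "cmod (H z * of_real (g z)) \<le> \<bar>C\<bar> * cmod (H z)" for z
      proof (cases "z \<in> S")
        case True
        then have "\<bar>g z\<bar> \<le> \<bar>C\<bar>" using C[of z] by linarith
        then show ?thesis unfolding norm_mult norm_of_real mult.commute[of "\<bar>C\<bar>"] by (rule mult_left_mono) simp
      qed (use supp in simp)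
      then show "AE z in lborel. cmod (H z * of_real (g z)) \<le> cmod (of_real C * H z)"
        by (simp add: norm_mult)
    qed
  qed
  have sum0: "(\<integral>z. H z * of_real (g z) \<partial>lborel) = 0" if "exponential_sum \<sigma> g" for g
    using that
  proof induction
    case (monomial \<kappa> c y)
    have "(\<integral>z. H z * of_real (c * exp (\<kappa> * (\<sigma> * (fst z + snd z)) + y * (snd z - fst z))) \<partial>lborel)
      = (\<integral>z. of_real c * (H z * of_real (exp (\<kappa> * (\<sigma> * (fst z + snd z)) + y * (snd z - fst z)))) \<partial>lborel)"
      by (simp add: mult_ac)
    then show ?case using zero[OF monomial] by simp
  next
    case (add g h)
    then show ?case
      using int[of g] int[of h] exponential_sum_continuous[of \<sigma>] by (simp add: distrib_left)
  qed
  define N where "N = (\<integral>z. cmod (H z) \<partial>lborel)"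
  have "cmod (\<integral>z. H z * of_real (f z) \<partial>lborel) \<le> e" if "e > 0" for e
  proof -
    have N: "N \<ge> 0" by (simp add: N_def)
    then have "e / (N + 1) > 0" using that by simp
    from exponential_sum_approximation[OF \<sigma> S continuous_on_subset[OF f subset_UNIV] this]
    obtain g where g: "exponential_sum \<sigma> g" "\<And>z. z \<in> S \<Longrightarrow> \<bar>f z - g z\<bar> < e / (N + 1)"
      by blast
    note gc = exponential_sum_continuous[OF g(1), of UNIV]
    have "(\<integral>z. H z * of_real (f z) \<partial>lborel) = (\<integral>z. H z * of_real (f z - g z) \<partial>lborel)"
      using int[OF f] int[OF gc] sum0[OF g(1)] by (simp add: right_diff_distrib)
    also have "cmod \<dots> \<le> (\<integral>z. cmod (H z * of_real (f z - g z)) \<partial>lborel)"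
      by (rule integral_norm_bound)
    also have "\<dots> \<le> (\<integral>z. cmod (H z) * (e / (N + 1)) \<partial>lborel)"
    proof (rule integral_mono)
      show "integrable lborel (\<lambda>z. cmod (H z * of_real (f z - g z)))"
        by (intro integrable_norm int continuous_on_diff f gc)
      show "cmod (H z * of_real (f z - g z)) \<le> cmod (H z) * (e / (N + 1))" for z
      proof (cases "z \<in> S")
        case True
        then show ?thesis unfolding norm_mult norm_of_real
          using g(2)[OF True] by (intro mult_left_mono) auto
      qed (use supp in simp)
    qed (use H in auto)
    also have "\<dots> = N * (e / (N + 1))" by (simp add: N_def)
    also have "\<dots> \<le> e" using N that by (simp add: field_simps)
    finally show ?thesis .
  qed
  then have "cmod (\<integral>z. H z * of_real (f z) \<partial>lborel) \<le> 0" by (rule field_le_epsilon) auto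
  then show ?thesis by simp
qed

section \<open>Recovering a function up to a phase\<close>

lemma AE_nonpos_if_set_integrals_zero:
  fixes h :: "'a \<Rightarrow> real"
  assumes h: "integrable M h" and zero: "\<And>A. A \<in> sets M \<Longrightarrow> (LINT x:A|M. h x) = 0"
  shows "AE x in M. h x \<le> 0"
proof -
  define A where "A = {x \<in> space M. h x > 0}"
  have A: "A \<in> sets M" unfolding A_def using h by measurable
  have "integrable M (\<lambda>x. indicator A x *\<^sub>R h x)"
    using A h by (rule integrable_mult_indicator)
  moreover have "AE x in M. indicator A x *\<^sub>R h x \<ge> 0"
    by (auto simp: A_def indicator_def)
  ultimately have "AE x in M. indicator A x *\<^sub>R h x = 0"
    using zero[OF A] integral_nonneg_eq_0_iff_AE unfolding set_lebesgue_integral_def by blast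
  then show ?thesis
    by (rule AE_mp) (auto simp: A_def indicator_def intro!: AE_I2)
qed

lemma AE_zero_if_set_integrals_zero:
  fixes H :: "'a \<Rightarrow> complex"
  assumes H: "integrable M H" and zero: "\<And>A. A \<in> sets M \<Longrightarrow> (LINT x:A|M. H x) = 0"
  shows "AE x in M. H x = 0"
proof -
  have real: "AE x in M. h x = 0"
    if h: "integrable M h" and z: "\<And>A. A \<in> sets M \<Longrightarrow> (LINT x:A|M. h x) = 0" for h :: "'a \<Rightarrow> real"
  proof -
    have "AE x in M. - h x \<le> 0"
      using h z by (intro AE_nonpos_if_set_integrals_zero) (auto simp: set_lebesgue_integral_def)
    moreover have "AE x in M. h x \<le> 0"
      using h z by (rule AE_nonpos_if_set_integrals_zero)
    ultimately show ?thesis by eventually_elim auto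
  qed
  have int: "integrable M (\<lambda>x. indicator A x *\<^sub>R H x)" if "A \<in> sets M" for A
    using that H by (rule integrable_mult_indicator)
  have "AE x in M. Re (H x) = 0"
  proof (rule real)
    fix A assume "A \<in> sets M"
    then show "(LINT x:A|M. Re (H x)) = 0"
      using integral_Re[OF int] zero unfolding set_lebesgue_integral_def by simp
  qed (use H in simp)
  moreover have "AE x in M. Im (H x) = 0"
  proof (rule real)
    fix A assume "A \<in> sets M"
    then show "(LINT x:A|M. Im (H x)) = 0"
      using integral_Im[OF int] zero unfolding set_lebesgue_integral_def by simp
  qed (use H in simp)
  ultimately show ?thesis by eventually_elim (simp add: complex_eq_iff)
qed

lemma indicator_open_limit_continuous:
  fixes U :: "'a::metric_space set"
  assumes "open U"
  obtains f :: "nat \<Rightarrow> 'a \<Rightarrow> real"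
  where "\<And>n. continuous_on UNIV (f n)" "\<And>n x. \<bar>f n x\<bar> \<le> 1" "\<And>x. (\<lambda>n. f n x) \<longlonglongrightarrow> indicator U x"
proof (cases "U = UNIV")
  case True
  then show ?thesis using that[of "\<lambda>_ _. 1"] by simp
next
  case False
  define f where "f n x = min 1 (real n * infdist x (- U))" for n x
  show ?thesis
  proof (rule that[of f])
    show "continuous_on UNIV (f n)" for n
      unfolding f_def by (intro continuous_intros)
    show "\<bar>f n x\<bar> \<le> 1" for n x
      unfolding f_def using infdist_nonneg[of x "- U"] by (auto simp: min_def)
    show "(\<lambda>n. f n x) \<longlonglongrightarrow> indicator U x" for x
    proof (cases "x \<in> U")
      case True
      then have pos: "infdist x (- U) > 0"
        using False assms by (intro infdist_pos_not_in_closed) auto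
      then obtain N :: nat where N: "1 < real N * infdist x (- U)"
        using reals_Archimedean3 by blast
      have "f n x = 1" if "n \<ge> N" for n
      proof -
        have "real N * infdist x (- U) \<le> real n * infdist x (- U)"
          using that pos by (intro mult_right_mono) auto
        then show ?thesis using N by (simp add: f_def)
      qed
      then have "eventually (\<lambda>n. f n x = 1) sequentially"
        unfolding eventually_sequentially by blast
      then show ?thesis using True by (simp add: tendsto_eventually)
    next
      case False
      then show ?thesis by (simp add: f_def)
    qed
  qed
qed

text \<open>
  Indicators of open sets are bounded pointwise limits of continuous functions, and open sets form an
  intersection-stable generator of the Borel sets.
\<close>

lemma AE_zero_if_continuous_integrals_zero:
  fixes H :: "'a::metric_space \<Rightarrow> complex"
  assumes H: "integrable M H" and sets: "sets M = sets borel"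
    and zero: "\<And>f. continuous_on UNIV f \<Longrightarrow> (\<integral>x. H x * of_real (f x) \<partial>M) = 0"
  shows "AE x in M. H x = 0"
proof (rule AE_zero_if_set_integrals_zero[OF H])
  have space: "space M = UNIV" using sets_eq_imp_space_eq[OF sets] by simp
  have open_zero: "(LINT x:U|M. H x) = 0" if U: "open U" for U
  proof -
    obtain f :: "nat \<Rightarrow> 'a \<Rightarrow> real" where f: "\<And>n. continuous_on UNIV (f n)" "\<And>n x. \<bar>f n x\<bar> \<le> 1"
      "\<And>x. (\<lambda>n. f n x) \<longlonglongrightarrow> indicator U x"
      using indicator_open_limit_continuous[OF U] by blast
    have "(\<lambda>n. \<integral>x. H x * of_real (f n x) \<partial>M) \<longlonglongrightarrow> (\<integral>x. indicator U x *\<^sub>R H x \<partial>M)"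
    proof (rule integral_dominated_convergence[where w = "\<lambda>x. cmod (H x)"])
      have "U \<in> sets M" using U sets by simp
      then show "(\<lambda>x. indicator U x *\<^sub>R H x) \<in> borel_measurable M"
        using H by measurable
      have "f n \<in> borel_measurable M" for n
        using f(1) sets by (simp add: borel_measurable_continuous_onI cong: measurable_cong_sets)
      then show "(\<lambda>x. H x * of_real (f n x)) \<in> borel_measurable M" for n
        using H by measurable
      show "AE x in M. (\<lambda>n. H x * of_real (f n x)) \<longlonglongrightarrow> indicator U x *\<^sub>R H x"
      proof (rule AE_I2)
        fix x
        have "(\<lambda>n. H x * of_real (f n x)) \<longlonglongrightarrow> H x * of_real (indicator U x)"
          by (intro tendsto_intros f)
        then show "(\<lambda>n. H x * of_real (f n x)) \<longlonglongrightarrow> indicator U x *\<^sub>R H x"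
          by (simp add: scaleR_conv_of_real mult.commute)
      qed
      show "AE x in M. cmod (H x * of_real (f n x)) \<le> cmod (H x)" for n
        using f(2) by (auto simp: norm_mult intro!: AE_I2 mult_left_le)
    qed (use H in simp)
    then have "(\<lambda>n. 0) \<longlonglongrightarrow> (LINT x:U|M. H x)"
      using zero[OF f(1)] by (simp add: set_lebesgue_integral_def)
    then show ?thesis by (simp add: LIMSEQ_const_iff)
  qed
  fix A assume "A \<in> sets M"
  then have A: "A \<in> sigma_sets UNIV {S. open S}"
    using sets by (simp add: borel_def)
  have stable: "Int_stable {S :: 'a set. open S}" by (auto simp: Int_stable_def)
  have meas: "B \<in> sets M" if "B \<in> sigma_sets UNIV {S. open S}" for B
    using that sets by (simp add: borel_def)
  have "{S :: 'a set. open S} \<subseteq> Pow UNIV" by simp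
  from stable this A show "(LINT x:A|M. H x) = 0"
  proof (induction rule: sigma_sets_induct_disjoint)
    case (compl B)
    have B: "B \<in> sets M" using compl meas by blast
    have "set_integrable M B H" "set_integrable M (UNIV - B) H"
      using H B sets.compl_sets[OF B] space unfolding set_integrable_def
      by (auto intro: integrable_mult_indicator)
    then have "(LINT x:B \<union> (UNIV - B)|M. H x) = (LINT x:B|M. H x) + (LINT x:(UNIV - B)|M. H x)"
      by (intro set_integral_Un) auto
    then show ?case using open_zero[of UNIV] compl by simp
  next
    case (union B)
    have B: "B i \<in> sets M" for i using union meas by blast
    have "set_integrable M (\<Union>i. B i) H"
      using H B unfolding set_integrable_def
      by (intro integrable_mult_indicator) (auto intro!: sets.countable_UN)
    then have "(LINT x:(\<Union>i. B i)|M. H x) = (\<Sum>i. LINT x:(B i)|M. H x)"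
      using union B by (intro lebesgue_integral_countable_add) (auto simp: disjoint_family_on_def)
    then show ?case using union by simp
  qed (use open_zero in \<open>auto simp: set_lebesgue_integral_def\<close>)
qed

lemma AE_neg_witness:
  assumes "AE x in M. P x" "\<not> (AE x in M. Q x)"
  obtains x where "P x" "\<not> Q x"
proof (rule ccontr)
  assume "\<not> thesis"
  then have "P x \<Longrightarrow> Q x" for x using that by blast
  with assms(1) have "AE x in M. Q x" by (auto elim: eventually_mono)
  with assms(2) show False by contradiction
qed

text \<open>
  Fixing one good value of \<open>t\<close> with \<open>F t \<noteq> 0\<close> gives \<open>F = c G\<close> almost
  everywhere; inserting this back yields \<open>\<bar>c\<bar>\<^sup>2 = 1\<close>. If \<open>F\<close> vanishes
  almost everywhere, so does \<open>G\<close>.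
\<close>

lemma phase_if_tensor_squares_eq:
  fixes F G :: "real \<Rightarrow> complex"
  assumes eq: "AE t in lborel. AE s in lborel. F t * cnj (F s) = G t * cnj (G s)"
  obtains \<alpha> where "AE t in lborel. F t = cis \<alpha> * G t"
proof (cases "AE t in lborel. F t = 0")
  case F0: True
  have "AE t in lborel. G t = 0"
  proof (rule ccontr)
    assume nz: "\<not> (AE t in lborel. G t = 0)"
    have "AE t in lborel. F t = 0 \<and> (AE s in lborel. F t * cnj (F s) = G t * cnj (G s))"
      using F0 eq by eventually_elim auto
    from AE_neg_witness[OF this nz]
    obtain t where "F t = 0" "AE s in lborel. F t * cnj (F s) = G t * cnj (G s)" "G t \<noteq> 0" by blast
    then have "AE s in lborel. G s = 0" by simp
    with nz show False by blast
  qed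
  with F0 have "AE t in lborel. F t = cis 0 * G t" by eventually_elim auto
  then show ?thesis by (rule that)
next
  case F: False
  from AE_neg_witness[OF eq F]
  obtain t where t: "AE s in lborel. F t * cnj (F s) = G t * cnj (G s)" "F t \<noteq> 0" by blast
  \<comment> \<open>The value of the equation at the good point, solved for \<open>F s\<close> after conjugation.\<close>
  define c where "c = cnj (G t) / cnj (F t)"
  have FG: "AE s in lborel. F s = c * G s"
    using t(1)
  proof eventually_elim
    case (elim s)
    then have "cnj (F t * cnj (F s)) = cnj (G t * cnj (G s))" by simp
    then show ?case using t(2) by (simp add: c_def field_simps)
  qed
  have G: "\<not> (AE t in lborel. G t = 0)"
  proof
    assume "AE t in lborel. G t = 0"
    with FG have "AE t in lborel. F t = 0" by eventually_elim auto
    with F show False by blast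
  qed
  have "AE t in lborel. F t = c * G t \<and> (AE s in lborel. F t * cnj (F s) = G t * cnj (G s))"
    using FG eq by eventually_elim auto
  from AE_neg_witness[OF this G]
  obtain u where u: "F u = c * G u" "AE s in lborel. F u * cnj (F s) = G u * cnj (G s)" "G u \<noteq> 0" by blast
  have "AE s in lborel. F s = c * G s \<and> F u * cnj (F s) = G u * cnj (G s)"
    using FG u(2) by eventually_elim auto
  from AE_neg_witness[OF this G]
  obtain s where s: "F s = c * G s" "F u * cnj (F s) = G u * cnj (G s)" "G s \<noteq> 0" by blast
  have "c * cnj c = 1" using s u by simp
  then have "cmod c = 1" by (metis complex_mod_cnj complex_mod_mult_cnj norm_one power2_eq_1_iff norm_ge_zero not_one_le_zero neg_0_le_iff_le)
  then have "c \<noteq> 0" "sgn c = c" by (auto simp: sgn_eq)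
  then have "cis (Arg c) = c" using cis_Arg[of c] by simp
  with FG that[of "Arg c"] show ?thesis by simp
qed

text \<open>
  On a bounded interval \<open>L\<^sup>p\<close> functions are integrable, since \<open>x \<le> 1 +
  x\<^sup>r\<close> for \<open>x \<ge> 0\<close> and \<open>r \<ge> 1\<close>. Cutting off to the interval makes
  the support condition hold at every point.
\<close>

lemma Lp_interval_integrable_representative:
  assumes p: "1 \<le> p" and F: "F \<in> Lp_interval p B"
  obtains F' where "integrable lborel F'" "\<And>t. t \<notin> {-B..B} \<Longrightarrow> F' t = 0" "distr_of_fun F = distr_of_fun F'"
proof -
  have [measurable]: "F \<in> borel_measurable borel" using F by (simp add: Lp_interval_def)
  have supp: "AE t in lborel. t \<notin> {-B..B} \<longrightarrow> F t = 0" using F by (simp add: Lp_interval_def)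
  define F' where "F' t = indicator {-B..B} t * F t" for t
  have [measurable]: "F' \<in> borel_measurable borel" unfolding F'_def by measurable
  have eq: "AE t in lborel. F t = F' t"
    using supp by eventually_elim (auto simp: F'_def indicator_def)
  have ind: "integrable lborel (indicator {-B..B} :: real \<Rightarrow> real)"
    by (simp add: emeasure_lborel_Icc_eq)
  have "integrable lborel F'"
  proof (cases "p = \<infinity>")
    case True
    then obtain C where C: "AE t in lborel. cmod (F t) \<le> C" using F by (auto simp: Lp_interval_def)
    show ?thesis
    proof (rule Bochner_Integration.integrable_bound)
      show "integrable lborel (\<lambda>t. C * indicator {-B..B} t)" using ind by simp
      show "AE t in lborel. norm (F' t) \<le> norm (C * indicator {-B..B} t)"
        using C by eventually_elim (auto simp: F'_def indicator_def)
    qed simp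
  next
    case False
    define r where "r = enn2real p"
    have r: "r \<ge> 1"
      using p False enn2real_mono[of 1 p] by (simp add: r_def top.not_eq_extremum)
    have int: "integrable lborel (\<lambda>t. cmod (F t) powr r)"
      using F False by (simp add: Lp_interval_def r_def)
    show ?thesis
    proof (rule Bochner_Integration.integrable_bound)
      show "integrable lborel (\<lambda>t. indicator {-B..B} t + cmod (F t) powr r)"
        using ind int by (rule Bochner_Integration.integrable_add)
      have "x \<le> 1 + x powr r" if "x \<ge> 0" for x :: real
      proof (cases "x \<le> 1")
        case False
        then have "x powr 1 \<le> x powr r" using r by (intro powr_mono) auto
        then show ?thesis using that by simp
      qed (use that in \<open>simp add: add_increasing2\<close>)
      then have "norm (F' t) \<le> norm (indicator {-B..B} t + cmod (F t) powr r)" for t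
        unfolding real_norm_def
        by (intro order.trans[OF _ abs_ge_self]) (auto simp: F'_def indicator_def)
      then show "AE t in lborel. norm (F' t) \<le> norm (indicator {-B..B} t + cmod (F t) powr r)"
        by simp
    qed simp
  qed
  moreover have "distr_of_fun F \<psi> = distr_of_fun F' \<psi>" for \<psi>
  proof (cases "\<psi> \<in> schwartz_space")
    case True
    have [measurable]: "\<psi> \<in> borel_measurable borel" using True by (rule schwartz_measurable)
    have "AE t in lborel. F t * \<psi> t = F' t * \<psi> t"
      using eq by eventually_elim simp
    then have "(LINT t|lborel. F t * \<psi> t) = (LINT t|lborel. F' t * \<psi> t)"
      by (intro integral_cong_AE) simp_all
    then show ?thesis by (simp add: distr_of_fun_def)
  qed (simp add: distr_of_fun_def)
  ultimately show ?thesis by (intro that[of F']) (auto simp: F'_def)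
qed

text \<open>
  The kernel difference, damped by a positive Gaussian weight, is orthogonal to all exponentials
  \<open>exp(2\<pi>\<omega>(t+s))
  exp(y(s-t))\<close> with \<open>\<omega> \<in> \<Omega>\<close>. For each
  \<open>y\<close> the Muntz argument in the variable \<open>t + s\<close> extends this to a half-line of
  exponents, and density of exponential sums finishes the proof.
\<close>

lemma tensor_squares_eq:
  assumes U: "uniqueness_set_PW 1 (2 * B) X"
    and div: "\<not> (\<lambda>\<omega>. 1 / \<bar>\<omega>\<bar>) summable_on (\<Omega> - {0})"
    and F: "integrable lborel F" "\<And>t. t \<notin> {-B..B} \<Longrightarrow> F t = 0"
    and G: "integrable lborel G" "\<And>t. t \<notin> {-B..B} \<Longrightarrow> G t = 0"
    and eq: "\<And>a b. a \<in> \<Omega> \<Longrightarrow> b \<in> X \<Longrightarrow>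
      cmod (LINT t|lborel. F t * gabor_atom a b t) = cmod (LINT t|lborel. G t * gabor_atom a b t)"
  shows "AE t in lborel. AE s in lborel. F t * cnj (F s) = G t * cnj (G s)"
proof -
  let ?w = "\<lambda>z::real \<times> real. exp (- pi * ((fst z)\<^sup>2 + (snd z)\<^sup>2 + (snd z - fst z)\<^sup>2))"
  define H where "H z = gram_difference F G z * of_real (?w z)" for z
  have w: "(\<lambda>z. complex_of_real (?w z)) \<in> borel_measurable (lborel \<Otimes>\<^sub>M lborel)" "\<And>z. cmod (of_real (?w z)) \<le> 1"
    by simp_all
  have H: "integrable (lborel \<Otimes>\<^sub>M lborel) H"
    using integrable_bounded_mult[OF integrable_gram_difference[OF F(1) G(1)] w]
    unfolding H_def by (simp only: mult.commute[of "gram_difference F G _"])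
  define S where "S = {-B..B} \<times> {-B..B}"
  have supp: "H z = 0" if "z \<notin> S" for z
    using that F(2) G(2) unfolding H_def gram_difference_def S_def
    by (auto simp: case_prod_unfold mem_Times_iff simp del: atLeastAtMost_iff)
  obtain \<sigma> :: real where \<sigma>: "\<sigma> = 1 \<or> \<sigma> = -1"
    and half: "\<not> (\<lambda>\<omega>. 1 / \<omega>) summable_on {\<omega>. \<omega> > 0 \<and> \<sigma> * \<omega> \<in> \<Omega>}"
    using divergent_half_line[OF div] by blast
  have zero: "(\<integral>z. H z * of_real (exp (\<kappa> * (- \<sigma> * (fst z + snd z)) + y * (snd z - fst z))) \<partial>lborel) = 0"
    if "\<kappa> \<ge> 0" for \<kappa> y
  proof -
    define Hy where "Hy z = H z * of_real (exp (y * (snd z - fst z)))" for z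
    define v where "v z = \<sigma> * (2 * pi * (fst z + snd z))" for z :: "real \<times> real"
    have Hy_int: "integrable (lborel \<Otimes>\<^sub>M lborel) Hy"
    proof (rule Bochner_Integration.integrable_bound)
      show "integrable (lborel \<Otimes>\<^sub>M lborel) (\<lambda>z. of_real (exp (\<bar>y\<bar> * (2 * B))) * H z)" using H by simp
      show "Hy \<in> borel_measurable (lborel \<Otimes>\<^sub>M lborel)" using H unfolding Hy_def by measurable
      have "cmod (Hy z) \<le> exp (\<bar>y\<bar> * (2 * B)) * cmod (H z)" for z
      proof (cases "z \<in> S")
        case True
        then have "\<bar>snd z - fst z\<bar> \<le> 2 * B" by (auto simp: S_def)
        then have "\<bar>y * (snd z - fst z)\<bar> \<le> \<bar>y\<bar> * (2 * B)"
          unfolding abs_mult by (rule mult_left_mono) simp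
        then have "y * (snd z - fst z) \<le> \<bar>y\<bar> * (2 * B)" by linarith
        then show ?thesis by (simp add: Hy_def norm_mult mult.commute[of _ "cmod (H z)"] mult_left_mono)
      qed (simp add: supp Hy_def)
      then show "AE z in lborel \<Otimes>\<^sub>M lborel. cmod (Hy z) \<le> cmod (of_real (exp (\<bar>y\<bar> * (2 * B))) * H z)"
        by (simp add: norm_mult)
    qed
    have "(\<integral>z. Hy z * of_real (exp (- (\<kappa> / (2 * pi)) * v z)) \<partial>(lborel \<Otimes>\<^sub>M lborel)) = 0"
    proof (rule exponential_moments_vanish[OF _ half Hy_int])
      show "v \<in> borel_measurable (lborel \<Otimes>\<^sub>M lborel)" unfolding v_def by measurable
      show "\<bar>v z\<bar> \<le> 2 * pi * (2 * B)" if "Hy z \<noteq> 0" for z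
      proof -
        have "z \<in> S" using that supp[of z] by (auto simp: Hy_def)
        then have "\<bar>fst z + snd z\<bar> \<le> 2 * B" by (auto simp: S_def)
        then have "2 * pi * \<bar>fst z + snd z\<bar> \<le> 2 * pi * (2 * B)" by (intro mult_left_mono) auto
        then show ?thesis using \<sigma> by (auto simp: v_def abs_mult)
      qed
    next
      fix \<omega> assume "\<omega> \<in> {\<omega>. \<omega> > 0 \<and> \<sigma> * \<omega> \<in> \<Omega>}"
      then have \<omega>: "\<sigma> * \<omega> \<in> \<Omega>" by simp
      have "Hy z * of_real (exp (\<omega> * v z)) = gram_difference F G z * of_real (?w z *
          exp (2 * pi * (\<sigma> * \<omega>) * (fst z + snd z) + 2 * pi * (y / (2 * pi)) * (snd z - fst z)))" for z
      proof -
        have "2 * pi * (\<sigma> * \<omega>) * (fst z + snd z) + 2 * pi * (y / (2 * pi)) * (snd z - fst z)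
          = y * (snd z - fst z) + \<omega> * v z"
          by (simp add: v_def)
        then show ?thesis
          unfolding Hy_def H_def by (simp only: exp_add of_real_mult mult.assoc)
      qed
      then show "(\<integral>z. Hy z * of_real (exp (\<omega> * v z)) \<partial>(lborel \<Otimes>\<^sub>M lborel)) = 0"
        using spectrogram_orthogonality[OF U F G eq[OF \<omega>], of "y / (2 * pi)"] by simp
    qed (use that in simp_all)
    moreover have "Hy z * of_real (exp (- (\<kappa> / (2 * pi)) * v z)) = H z * of_real (exp (\<kappa> * (- \<sigma> * (fst z + snd z)) + y * (snd z - fst z)))" for z
    proof -
      have "\<kappa> * (- \<sigma> * (fst z + snd z)) + y * (snd z - fst z) = y * (snd z - fst z) + - (\<kappa> / (2 * pi)) * v z"
        by (simp add: v_def)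
      then show ?thesis
        unfolding Hy_def by (simp only: exp_add of_real_mult mult.assoc)
    qed
    ultimately show ?thesis by (simp add: lborel_prod)
  qed
  have "AE z in lborel. H z = 0"
  proof (rule AE_zero_if_continuous_integrals_zero)
    show "(\<integral>z. H z * of_real (f z) \<partial>lborel) = 0" if "continuous_on UNIV f" for f
    proof (rule integral_continuous_eq_0[OF _ _ supp _ zero that])
      show "compact S" unfolding S_def by (intro compact_Times compact_Icc)
      show "- \<sigma> \<noteq> 0" using \<sigma> by auto
    qed (use H in \<open>simp add: lborel_prod\<close>)
  qed (use H in \<open>auto simp: lborel_prod\<close>)
  then have "AE z in lborel \<Otimes>\<^sub>M lborel. H z = 0" unfolding lborel_prod .
  then have "AE t in lborel. AE s in lborel. H (t, s) = 0" by (rule lborel_pair.AE_pair)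
  then show ?thesis by (simp add: H_def gram_difference_def)
qed

text \<open>
  The factor depends on the point of the plane but not on the function, so it cancels when two moduli are
  compared.
\<close>

lemma gabor_frft:
  shows "\<exists>c. c \<noteq> 0 \<and> (\<forall>F. gabor (distr_ext (frft \<theta>) (distr_of_fun F)) (rotation \<theta> (a, b)) =
    c * (LINT t|lborel. F t * gabor_atom a b t))"
proof -
  obtain x \<omega> where x\<omega>: "rotation \<theta> (a, b) = (x, \<omega>)" by fastforce
  obtain c where c: "c \<noteq> 0" "frft \<theta> (gabor_atom x \<omega>) = (\<lambda>\<xi>. c * gabor_atom a b \<xi>)"
    using frft_gabor_atom[OF x\<omega>] by blast
  have "gabor (distr_ext (frft \<theta>) (distr_of_fun F)) (x, \<omega>) = c * (LINT t|lborel. F t * gabor_atom a b t)" for F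
  proof -
    have "(LINT t|lborel. F t * (c * gabor_atom a b t)) = (LINT t|lborel. c * (F t * gabor_atom a b t))"
      by (simp add: mult_ac)
    then show ?thesis
      unfolding gabor_def
      by (simp add: distr_ext_def distr_of_fun_def gabor_atom_schwartz schwartz_cmult c(2))
  qed
  then show ?thesis using c(1) x\<omega> by auto
qed

theorem theorem3p2:
  fixes p :: ennreal and B \<theta> :: real and X \<Omega> :: "real set" and f g :: distr
  assumes "1 \<le> p" and "B > 0"
    and "uniqueness_set_PW 1 (2 * B) X"
    and "countable \<Omega>"
    and "\<not> (\<lambda>\<omega>. 1 / \<bar>\<omega>\<bar>) summable_on (\<Omega> - {0})"
    and "f \<in> frft_Lp \<theta> p B" and "g \<in> frft_Lp \<theta> p B"
  shows "(\<exists>\<alpha>::real. f = (\<lambda>\<psi>. cis \<alpha> * g \<psi>)) \<longleftrightarrow>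
         (\<forall>z \<in> rotation \<theta> ` (\<Omega> \<times> X). cmod (gabor f z) = cmod (gabor g z))"
proof
  assume "\<exists>\<alpha>::real. f = (\<lambda>\<psi>. cis \<alpha> * g \<psi>)"
  then show "\<forall>z \<in> rotation \<theta> ` (\<Omega> \<times> X). cmod (gabor f z) = cmod (gabor g z)"
    by (auto simp: gabor_def norm_mult split: prod.splits)
next
  assume eq: "\<forall>z \<in> rotation \<theta> ` (\<Omega> \<times> X). cmod (gabor f z) = cmod (gabor g z)"
  have representative: "\<exists>F. integrable lborel F \<and> (\<forall>t. t \<notin> {-B..B} \<longrightarrow> F t = 0) \<and>
      h = distr_ext (frft \<theta>) (distr_of_fun F)" if h: "h \<in> frft_Lp \<theta> p B" for h
  proof -
    obtain F where F: "F \<in> Lp_interval p B" "h = distr_ext (frft \<theta>) (distr_of_fun F)"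
      using h by (auto simp: frft_Lp_def)
    from Lp_interval_integrable_representative[OF \<open>1 \<le> p\<close> F(1)]
    obtain F' where "integrable lborel F'" "\<And>t. t \<notin> {-B..B} \<Longrightarrow> F' t = 0" "distr_of_fun F = distr_of_fun F'"
      by blast
    with F(2) show ?thesis by auto
  qed
  obtain F where F: "integrable lborel F" "\<And>t. t \<notin> {-B..B} \<Longrightarrow> F t = 0"
    and f: "f = distr_ext (frft \<theta>) (distr_of_fun F)"
    using representative[OF assms(6)] by blast
  obtain G where G: "integrable lborel G" "\<And>t. t \<notin> {-B..B} \<Longrightarrow> G t = 0"
    and g: "g = distr_ext (frft \<theta>) (distr_of_fun G)"
    using representative[OF assms(7)] by blast
  have "AE t in lborel. AE s in lborel. F t * cnj (F s) = G t * cnj (G s)"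
  proof (rule tensor_squares_eq[OF assms(3,5) F G])
    fix a b assume ab: "a \<in> \<Omega>" "b \<in> X"
    obtain c where c: "c \<noteq> 0" "\<And>F. gabor (distr_ext (frft \<theta>) (distr_of_fun F)) (rotation \<theta> (a, b)) =
        c * (LINT t|lborel. F t * gabor_atom a b t)"
      using gabor_frft by blast
    have "cmod (gabor f (rotation \<theta> (a, b))) = cmod (gabor g (rotation \<theta> (a, b)))"
      using eq ab by blast
    then show "cmod (LINT t|lborel. F t * gabor_atom a b t) = cmod (LINT t|lborel. G t * gabor_atom a b t)"
      unfolding f g c(2) norm_mult using c(1) by simp
  qed
  then obtain \<alpha> where \<alpha>: "AE t in lborel. F t = cis \<alpha> * G t"
    by (rule phase_if_tensor_squares_eq)
  have "distr_of_fun F \<psi> = cis \<alpha> * distr_of_fun G \<psi>" for \<psi>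
  proof (cases "\<psi> \<in> schwartz_space")
    case True
    have [measurable]: "\<psi> \<in> borel_measurable borel" using True by (rule schwartz_measurable)
    have [measurable]: "F \<in> borel_measurable borel" "G \<in> borel_measurable borel" using F G by auto
    have "AE t in lborel. F t * \<psi> t = cis \<alpha> * (G t * \<psi> t)"
      using \<alpha> by eventually_elim simp
    then have "(LINT t|lborel. F t * \<psi> t) = (LINT t|lborel. cis \<alpha> * (G t * \<psi> t))"
      by (intro integral_cong_AE) simp_all
    then show ?thesis using True by (simp add: distr_of_fun_def)
  qed (simp add: distr_of_fun_def)
  then have "f = (\<lambda>\<psi>. cis \<alpha> * g \<psi>)" by (auto simp: f g distr_ext_def fun_eq_iff)
  then show "\<exists>\<alpha>::real. f = (\<lambda>\<psi>. cis \<alpha> * g \<psi>)" by blast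
qed

end
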